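(* Let $K$ be any field, let $\alpha\in K$ with $\alpha\ne0$, and let $L_{10}$ be the three-dimensional Leibniz algebra over $K$ with basis $\{e_1,e_2,e_3\}$ and nonzero products of basis elements $e_1e_3=e_2$, $e_2e_3=\alpha e_1+e_2$. (1) If $K$ is infinite, then the $T$-ideal of all polynomial identities of $L_{10}$ is generated by the polynomial $x_1(x_2x_3)$. (2) If $K$ is finite with cardinality $|K|=q$, and $r_1,r_2$ are the roots (in an algebraic closure of $K$) of $p(t)=t^2-t-\alpha$, then the $T$-ideal $T(L_{10})$ is generated as follows: (i) if $r_1$ and $r_2$ are distinct elements of $K$, by \[ x_1(x_2x_3)\quad\text{and}\quad x_1x_2^{(q)}-x_1x_2; \] (ii) if $r_1=r_2=r$ in $K$ (i.e. $r$ is a repeated root), by \[ x_1(x_2x_3),\qquad x_1x_2x_3^{(q)}-x_1x_2^{(q)}x_3,\quad\text{and}\quad x_1x_2^{(2q-1)}-2x_1x_2^{(q)}+x_1x_2; \] (iii) if both roots $r_1$ and $r_2$ do not lie in $K$, by \[ x_1(x_2x_3),\qquad x_1x_2x_3^{(q)}-x_1x_2^{(q)}x_3,\quad\text{and}\quad x_1x_2^{(2q-1)}+\alpha^{-1}(1+2\alpha)x_1x_2^{(q)}+x_1x_2 . \]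
   Context: A (right) Leibniz algebra over $K$ is a $K$-algebra satisfying $x(yz)=(xy)z-(xz)y$. Identities live in the free Leibniz algebra $\mathcal L\langle X\rangle$ over $K$ on $X=\{x_1,x_2,\dots\}$; $T(L)$ is the set of polynomials vanishing under all substitutions of elements of $L$. A $T$-ideal is an ideal invariant under all endomorphisms of $\mathcal L\langle X\rangle$, and it is generated by $S$ if it is the smallest $T$-ideal containing $S$. Products without brackets are left-normed, and $x^{(m)}$ means $m$ consecutive occurrences of $x$ in a left-normed product (so $x_1x_2^{(q)}x_3$ is $x_1$ multiplied on the right $q$ times by $x_2$, then by $x_3$). Products of basis elements not listed are zero. *)

theory Defs
  imports "HOL-Analysis.Cartesian_Space" "HOL-Algebra.Algebraic_Closure_Type"
begin

section \<open>Leibniz algebras\<close>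

locale leibniz_algebra = vector_space scl
  for scl :: "'k::field \<Rightarrow> 'b::ab_group_add \<Rightarrow> 'b" +
  fixes mul :: "'b \<Rightarrow> 'b \<Rightarrow> 'b"
  assumes mul_add_left: "mul (x + y) z = mul x z + mul y z"
    and mul_add_right: "mul x (y + z) = mul x y + mul x z"
    and mul_scale_left: "mul (scl c x) y = scl c (mul x y)"
    and mul_scale_right: "mul x (scl c y) = scl c (mul x y)"
    and leibniz: "mul x (mul y z) = mul (mul x y) z - mul (mul x z) y"

definition algebra_hom ::
  "('k::field \<Rightarrow> 'a::ab_group_add \<Rightarrow> 'a) \<Rightarrow> ('a \<Rightarrow> 'a \<Rightarrow> 'a) \<Rightarrow>
   ('k \<Rightarrow> 'b::ab_group_add \<Rightarrow> 'b) \<Rightarrow> ('b \<Rightarrow> 'b \<Rightarrow> 'b) \<Rightarrow> ('a \<Rightarrow> 'b) \<Rightarrow> bool" where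
  "algebra_hom s1 m1 s2 m2 \<phi> \<longleftrightarrow>
     Vector_Spaces.linear s1 s2 \<phi> \<and> (\<forall>x y. \<phi> (m1 x y) = m2 (\<phi> x) (\<phi> y))"


section \<open>The free Leibniz algebra\<close>

text \<open>
  The free Leibniz algebra on countably many generators is built as the free object of the variety:
  terms in the algebra operations modulo the least congruence that contains all instances of the
  axioms of a Leibniz algebra over the field. That the result is free is proved below
  (\<open>free_leibniz_universal\<close>). The generators are numbered from 0, so the variable $x_i$ is \<open>gen (i - 1)\<close>.
\<close>

datatype 'k lterm =
    LVar nat
  | LZero
  | LAdd "'k lterm" "'k lterm"
  | LScale 'k "'k lterm"
  | LMul "'k lterm" "'k lterm"

inductive lcong :: "'k::field lterm \<Rightarrow> 'k lterm \<Rightarrow> bool" where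
  lrefl: "lcong s s"
| lsym: "lcong s t \<Longrightarrow> lcong t s"
| ltrans: "lcong s t \<Longrightarrow> lcong t u \<Longrightarrow> lcong s u"
| lcong_add: "lcong s s' \<Longrightarrow> lcong t t' \<Longrightarrow> lcong (LAdd s t) (LAdd s' t')"
| lcong_scale: "lcong s s' \<Longrightarrow> lcong (LScale c s) (LScale c s')"
| lcong_mul: "lcong s s' \<Longrightarrow> lcong t t' \<Longrightarrow> lcong (LMul s t) (LMul s' t')"
| ladd_assoc: "lcong (LAdd (LAdd s t) u) (LAdd s (LAdd t u))"
| ladd_comm: "lcong (LAdd s t) (LAdd t s)"
| ladd_zero: "lcong (LAdd LZero s) s"
| ladd_inv: "lcong (LAdd (LScale (-1) s) s) LZero"
| lscale_add_right: "lcong (LScale c (LAdd s t)) (LAdd (LScale c s) (LScale c t))"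
| lscale_add_left: "lcong (LScale (c + d) s) (LAdd (LScale c s) (LScale d s))"
| lscale_scale: "lcong (LScale c (LScale d s)) (LScale (c * d) s)"
| lscale_one: "lcong (LScale 1 s) s"
| lmul_add_left: "lcong (LMul (LAdd s t) u) (LAdd (LMul s u) (LMul t u))"
| lmul_add_right: "lcong (LMul s (LAdd t u)) (LAdd (LMul s t) (LMul s u))"
| lmul_scale_left: "lcong (LMul (LScale c s) t) (LScale c (LMul s t))"
| lmul_scale_right: "lcong (LMul s (LScale c t)) (LScale c (LMul s t))"
| lleibniz: "lcong (LMul s (LMul t u)) (LAdd (LMul (LMul s t) u) (LScale (-1) (LMul (LMul s u) t)))"

quotient_type (overloaded) 'k free_leibniz = "'k::field lterm" / lcong
proof (rule equivpI)
  show "reflp (lcong :: 'k lterm \<Rightarrow> _)" by (auto intro: reflpI lrefl)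
  show "symp (lcong :: 'k lterm \<Rightarrow> _)" by (auto intro: sympI lsym)
  show "transp (lcong :: 'k lterm \<Rightarrow> _)" by (auto intro: transpI ltrans)
qed

instantiation free_leibniz :: (field) "{ab_group_add, times}"
begin

lift_definition zero_free_leibniz :: "'a free_leibniz" is LZero .

lift_definition plus_free_leibniz :: "'a free_leibniz \<Rightarrow> 'a free_leibniz \<Rightarrow> 'a free_leibniz"
  is LAdd by (rule lcong_add)

lift_definition uminus_free_leibniz :: "'a free_leibniz \<Rightarrow> 'a free_leibniz"
  is "LScale (-1)" by (rule lcong_scale)

lift_definition minus_free_leibniz :: "'a free_leibniz \<Rightarrow> 'a free_leibniz \<Rightarrow> 'a free_leibniz"
  is "\<lambda>s t. LAdd s (LScale (-1) t)" by (intro lcong_add lcong_scale)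

lift_definition times_free_leibniz :: "'a free_leibniz \<Rightarrow> 'a free_leibniz \<Rightarrow> 'a free_leibniz"
  is LMul by (rule lcong_mul)

instance
proof
  fix a b c :: "'a free_leibniz"
  show "a + b + c = a + (b + c)" by transfer (rule ladd_assoc)
  show "a + b = b + a" by transfer (rule ladd_comm)
  show "0 + a = a" by transfer (rule ladd_zero)
  show "- a + a = 0" by transfer (rule ladd_inv)
  show "a - b = a + - b" by transfer (rule lrefl)
qed

end

lift_definition scale_fl :: "'k::field \<Rightarrow> 'k free_leibniz \<Rightarrow> 'k free_leibniz" (infixr "*\<^sub>F" 75)
  is LScale by (rule lcong_scale)

lift_definition gen :: "nat \<Rightarrow> 'k::field free_leibniz" is LVar .

lemma leibniz_algebra_free_leibniz:
  "leibniz_algebra (scale_fl :: 'k::field \<Rightarrow> _) (*)"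
proof unfold_locales
  fix a b :: 'k and x y z :: "'k free_leibniz"
  show "a *\<^sub>F (x + y) = a *\<^sub>F x + a *\<^sub>F y" by transfer (rule lscale_add_right)
  show "(a + b) *\<^sub>F x = a *\<^sub>F x + b *\<^sub>F x" by transfer (rule lscale_add_left)
  show "a *\<^sub>F b *\<^sub>F x = (a * b) *\<^sub>F x" by transfer (rule lscale_scale)
  show "1 *\<^sub>F x = x" by transfer (rule lscale_one)
  show "(x + y) * z = x * z + y * z" by transfer (rule lmul_add_left)
  show "x * (y + z) = x * y + x * z" by transfer (rule lmul_add_right)
  show "(a *\<^sub>F x) * y = a *\<^sub>F (x * y)" by transfer (rule lmul_scale_left)
  show "x * (a *\<^sub>F y) = a *\<^sub>F (x * y)" by transfer (rule lmul_scale_right)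
  show "x * (y * z) = x * y * z - x * z * y" by transfer (rule lleibniz)
qed

interpretation fl: leibniz_algebra "scale_fl :: 'k::field \<Rightarrow> _" "(*)"
  by (rule leibniz_algebra_free_leibniz)


section \<open>Substitution and polynomial identities\<close>

primrec lterm_eval ::
  "('k \<Rightarrow> 'b::ab_group_add \<Rightarrow> 'b) \<Rightarrow> ('b \<Rightarrow> 'b \<Rightarrow> 'b) \<Rightarrow> (nat \<Rightarrow> 'b) \<Rightarrow> 'k lterm \<Rightarrow> 'b" where
  "lterm_eval scl mul a (LVar i) = a i"
| "lterm_eval scl mul a LZero = 0"
| "lterm_eval scl mul a (LAdd s t) = lterm_eval scl mul a s + lterm_eval scl mul a t"
| "lterm_eval scl mul a (LScale c s) = scl c (lterm_eval scl mul a s)"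
| "lterm_eval scl mul a (LMul s t) = mul (lterm_eval scl mul a s) (lterm_eval scl mul a t)"

text \<open>
  The value does not depend on the chosen representative as soon as the target is a Leibniz
  algebra, see \<open>fl_eval_abs\<close> below.
\<close>

definition fl_eval ::
  "('k::field \<Rightarrow> 'b::ab_group_add \<Rightarrow> 'b) \<Rightarrow> ('b \<Rightarrow> 'b \<Rightarrow> 'b) \<Rightarrow> (nat \<Rightarrow> 'b) \<Rightarrow> 'k free_leibniz \<Rightarrow> 'b" where
  "fl_eval scl mul a f = lterm_eval scl mul a (rep_free_leibniz f)"

context leibniz_algebra
begin

lemma lterm_eval_lcong:
  "lcong s t \<Longrightarrow> lterm_eval scl mul a s = lterm_eval scl mul a t"
  by (induction rule: lcong.induct)
     (simp_all add: algebra_simps mul_add_left mul_add_right mul_scale_left mul_scale_right leibniz)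

lemma fl_eval_abs: "fl_eval scl mul a (abs_free_leibniz s) = lterm_eval scl mul a s"
  unfolding fl_eval_def
  by (rule lterm_eval_lcong) (rule rep_abs_rsp_left[OF Quotient3_free_leibniz lrefl])

lemma fl_eval_gen: "fl_eval scl mul a (gen i) = a i"
  and fl_eval_zero: "fl_eval scl mul a 0 = 0"
  and fl_eval_add: "fl_eval scl mul a (f + g) = fl_eval scl mul a f + fl_eval scl mul a g"
  and fl_eval_scale: "fl_eval scl mul a (c *\<^sub>F f) = scl c (fl_eval scl mul a f)"
  and fl_eval_mul: "fl_eval scl mul a (f * g) = mul (fl_eval scl mul a f) (fl_eval scl mul a g)"
proof -
  show "fl_eval scl mul a (gen i) = a i"
    by (simp add: gen.abs_eq fl_eval_abs)
  show "fl_eval scl mul a 0 = 0"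
    by (simp add: zero_free_leibniz.abs_eq fl_eval_abs)
  show "fl_eval scl mul a (f + g) = fl_eval scl mul a f + fl_eval scl mul a g"
    by (induct f rule: free_leibniz.abs_induct, induct g rule: free_leibniz.abs_induct)
       (simp add: plus_free_leibniz.abs_eq fl_eval_abs)
  show "fl_eval scl mul a (c *\<^sub>F f) = scl c (fl_eval scl mul a f)"
    by (induct f rule: free_leibniz.abs_induct) (simp add: scale_fl.abs_eq fl_eval_abs)
  show "fl_eval scl mul a (f * g) = mul (fl_eval scl mul a f) (fl_eval scl mul a g)"
    by (induct f rule: free_leibniz.abs_induct, induct g rule: free_leibniz.abs_induct)
       (simp add: times_free_leibniz.abs_eq fl_eval_abs)
qed

lemma algebra_hom_fl_eval: "algebra_hom scale_fl (*) scl mul (fl_eval scl mul a)"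
  unfolding algebra_hom_def Vector_Spaces.linear_iff
  using fl.vector_space_axioms vector_space_axioms
  by (simp add: fl_eval_add fl_eval_scale fl_eval_mul)

theorem free_leibniz_universal:
  "\<exists>!\<phi>. algebra_hom scale_fl (*) scl mul \<phi> \<and> (\<forall>i. \<phi> (gen i) = a i)"
proof (rule ex1I)
  show "algebra_hom scale_fl (*) scl mul (fl_eval scl mul a) \<and>
        (\<forall>i. fl_eval scl mul a (gen i) = a i)"
    by (simp add: algebra_hom_fl_eval fl_eval_gen)
next
  fix \<phi> assume \<phi>: "algebra_hom scale_fl (*) scl mul \<phi> \<and> (\<forall>i. \<phi> (gen i) = a i)"
  then have lin: "Vector_Spaces.linear scale_fl scl \<phi>"
    and mult: "\<And>x y. \<phi> (x * y) = mul (\<phi> x) (\<phi> y)" and gen: "\<And>i. \<phi> (gen i) = a i"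
    by (auto simp: algebra_hom_def)
  interpret \<phi>: Vector_Spaces.linear scale_fl scl \<phi> by (rule lin)
  have "\<phi> (abs_free_leibniz s) = lterm_eval scl mul a s" for s
  proof (induction s)
    case (LVar i) then show ?case by (simp add: gen flip: gen.abs_eq)
  next
    case LZero then show ?case by (simp add: \<phi>.zero flip: zero_free_leibniz.abs_eq)
  next
    case (LAdd s t) then show ?case by (simp add: \<phi>.add flip: plus_free_leibniz.abs_eq)
  next
    case (LScale c s) then show ?case by (simp add: \<phi>.scale flip: scale_fl.abs_eq)
  next
    case (LMul s t) then show ?case by (simp add: mult flip: times_free_leibniz.abs_eq)
  qed
  then have "\<phi> f = fl_eval scl mul a f" for f
    by (induct f rule: free_leibniz.abs_induct) (simp add: fl_eval_abs)
  then show "\<phi> = fl_eval scl mul a" by (rule ext)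
qed

end

definition identities ::
  "('k::field \<Rightarrow> 'b::ab_group_add \<Rightarrow> 'b) \<Rightarrow> ('b \<Rightarrow> 'b \<Rightarrow> 'b) \<Rightarrow> 'k free_leibniz set" where
  "identities scl mul = {f. \<forall>a. fl_eval scl mul a f = 0}"

definition fl_ideal :: "'k::field free_leibniz set \<Rightarrow> bool" where
  "fl_ideal I \<longleftrightarrow> fl.subspace I \<and> (\<forall>f\<in>I. \<forall>g. f * g \<in> I \<and> g * f \<in> I)"

definition T_ideal :: "'k::field free_leibniz set \<Rightarrow> bool" where
  "T_ideal I \<longleftrightarrow> fl_ideal I \<and>
     (\<forall>\<phi>. algebra_hom scale_fl (*) scale_fl (*) \<phi> \<longrightarrow> \<phi> ` I \<subseteq> I)"

definition T_ideal_gen :: "'k::field free_leibniz set \<Rightarrow> 'k free_leibniz set" where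
  "T_ideal_gen S = T_ideal hull S"

lemma T_ideal_T_ideal_gen: "T_ideal (T_ideal_gen (S :: 'k::field free_leibniz set))"
  unfolding T_ideal_gen_def
proof (rule hull_in)
  fix F :: "'k free_leibniz set set" assume F: "\<forall>I\<in>F. T_ideal I"
  then have "\<And>I. I \<in> F \<Longrightarrow> fl.subspace I" by (auto simp: T_ideal_def fl_ideal_def)
  then have "fl.subspace (\<Inter>F)" by (auto simp: fl.subspace_def)
  moreover have "\<phi> ` \<Inter>F \<subseteq> \<Inter>F" if "algebra_hom scale_fl (*) scale_fl (*) \<phi>" for \<phi> :: "'k free_leibniz \<Rightarrow> _"
    using F that unfolding T_ideal_def image_subset_iff by simp
  ultimately show "T_ideal (\<Inter>F)"
    using F unfolding T_ideal_def fl_ideal_def by simp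
qed

text \<open>
  \<open>rmul_pow x y m\<close> is the left-normed product $x y^{(m)}$. Other left-normed products need no
  notation, because \<open>*\<close> associates to the left.
\<close>

definition rmul_pow :: "'k::field free_leibniz \<Rightarrow> 'k free_leibniz \<Rightarrow> nat \<Rightarrow> 'k free_leibniz" where
  "rmul_pow x y m = ((\<lambda>u. u * y) ^^ m) x"

abbreviation "x\<^sub>1 \<equiv> gen 0"
abbreviation "x\<^sub>2 \<equiv> gen 1"
abbreviation "x\<^sub>3 \<equiv> gen 2"


section \<open>The algebra \<open>L\<^sub>1\<^sub>0\<close>\<close>

definition L10_table :: "'k::field \<Rightarrow> 3 \<Rightarrow> 3 \<Rightarrow> 'k ^ 3" where
  "L10_table \<alpha> i j =
     (if i = 1 \<and> j = 3 then axis 2 1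
      else if i = 2 \<and> j = 3 then \<alpha> *s axis 1 1 + axis 2 1
      else 0)"

definition L10_mul :: "'k::field \<Rightarrow> 'k ^ 3 \<Rightarrow> 'k ^ 3 \<Rightarrow> 'k ^ 3" where
  "L10_mul \<alpha> x y = (\<Sum>i\<in>UNIV. \<Sum>j\<in>UNIV. (x $ i * y $ j) *s L10_table \<alpha> i j)"

lemma leibniz_algebra_L10: "leibniz_algebra (*s) (L10_mul \<alpha>)"
  by unfold_locales
     (simp_all add: L10_mul_def L10_table_def vec_eq_iff forall_3 sum_3 axis_def algebra_simps)

end

theory Submission
  imports Defs
begin

text \<open>
  Modulo \<open>x\<^sub>1 (x\<^sub>2 x\<^sub>3)\<close> the free Leibniz algebra is spanned by the left-normed monomials
  \<open>x\<^sub>i M\<close>, where the order of the tail \<open>M\<close> is irrelevant. Sending \<open>x\<^sub>j\<close> to \<open>t\<^sub>j e\<^sub>3\<close>, plus \<open>e\<^sub>1\<close> if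
  \<open>j = i\<close>, maps \<open>x\<^sub>i M\<close> to \<open>t\<^sup>M R\<^sup>|\<^sup>M\<^sup>| e\<^sub>1\<close>, where \<open>R\<close> is right multiplication by \<open>e\<^sub>3\<close>, an invertible
  operator with \<open>R\<^sup>2 = R + \<alpha>\<close>. Over an infinite field these values are linearly independent as
  functions of \<open>t\<close>. Over a field with \<open>q\<close> elements the identities of (i) reduce all exponents below
  \<open>q\<close>, and those of (ii) and (iii) do so up to one extra factor \<open>x\<^sub>j\<^sup>(\<^sup>q\<^sup>-\<^sup>1\<^sup>)\<close>. On functions this
  factor acts as \<open>R\<^sup>q\<^sup>-\<^sup>1\<close>, which is a scalar only in case (i): \<open>R\<^sup>q\<close> is \<open>R\<close>, \<open>r\<close> or \<open>1 - R\<close> in the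
  three cases. So the reduced monomials remain independent.
\<close>

section \<open>Powers of the right multiplication by \<open>e\<^sub>3\<close>\<close>

text \<open>
  Right multiplication by \<open>e\<^sub>3\<close> acts on the span of \<open>e\<^sub>1, e\<^sub>2\<close> as an operator \<open>R\<close> with
  \<open>R\<^sup>2 = R + \<alpha>\<close>, and \<open>R\<^sup>n = lin_coeff \<alpha> n R + const_coeff \<alpha> n\<close>.
\<close>

fun lin_coeff const_coeff :: "'k::field \<Rightarrow> nat \<Rightarrow> 'k" where
  "lin_coeff \<alpha> 0 = 0"
| "lin_coeff \<alpha> (Suc n) = lin_coeff \<alpha> n + const_coeff \<alpha> n"
| "const_coeff \<alpha> 0 = 1"
| "const_coeff \<alpha> (Suc n) = \<alpha> * lin_coeff \<alpha> n"

text \<open>Compare coefficients in R^m R^n = R^(m+n), using R^2 = R + \<alpha>.\<close>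

lemma coeff_add:
  "lin_coeff \<alpha> (m + n) = lin_coeff \<alpha> m * lin_coeff \<alpha> n + lin_coeff \<alpha> m * const_coeff \<alpha> n
     + const_coeff \<alpha> m * lin_coeff \<alpha> n"
  "const_coeff \<alpha> (m + n) = \<alpha> * lin_coeff \<alpha> m * lin_coeff \<alpha> n + const_coeff \<alpha> m * const_coeff \<alpha> n"
proof (induction m)
  case (Suc m)
  { case 1 show ?case by (simp add: Suc distrib_left distrib_right add_ac mult_ac) }
  { case 2 show ?case by (simp add: Suc distrib_left distrib_right add_ac mult_ac) }
qed simp_all

lemma root_power_eq:
  assumes "r * r = r + (\<alpha> :: 'k::field)"
  shows "r ^ n = lin_coeff \<alpha> n * r + const_coeff \<alpha> n"
proof (induction n)
  case (Suc n)
  have "r ^ Suc n = lin_coeff \<alpha> n * (r * r) + const_coeff \<alpha> n * r"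
    by (simp add: Suc algebra_simps)
  then show ?case
    by (simp add: assms algebra_simps)
qed simp

lemma to_ac_coeff:
  "to_ac (lin_coeff \<alpha> n) = lin_coeff (to_ac \<alpha>) n"
  "to_ac (const_coeff \<alpha> n) = const_coeff (to_ac \<alpha>) n"
  by (induction n) simp_all

text \<open>The quantity is the determinant of R^n: R has trace 1 and determinant - \<alpha>, so det
  (a R + b) = b^2 + a b - \<alpha> a^2, and the value is (- \<alpha>)^n.\<close>

lemma coeff_norm_nonzero:
  assumes "\<alpha> \<noteq> 0"
  shows "const_coeff \<alpha> n * const_coeff \<alpha> n + lin_coeff \<alpha> n * const_coeff \<alpha> n
    - \<alpha> * lin_coeff \<alpha> n * lin_coeff \<alpha> n \<noteq> 0" (is "?N n \<noteq> 0")
proof (induction n)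
  case (Suc n)
  have "?N (Suc n) = - \<alpha> * ?N n"
    by (simp add: algebra_simps)
  with Suc assms show ?case by simp
qed simp

text \<open>
  The hypotheses say \<open>R\<^sup>k (c + d R\<^sup>m) = 0\<close>, and \<open>const_coeff \<alpha> (Suc m) \<noteq> 0\<close> says that \<open>R\<^sup>m\<close>
  is not a scalar.
\<close>

lemma coeff_independent:
  assumes "\<alpha> \<noteq> 0" and d: "d = 0 \<or> const_coeff \<alpha> (Suc m) \<noteq> 0"
    and const: "c * const_coeff \<alpha> k + d * const_coeff \<alpha> (k + m) = 0"
    and lin: "c * lin_coeff \<alpha> k + d * lin_coeff \<alpha> (k + m) = 0"
  shows "c = 0" "d = 0"
proof -
  define a b where "a = lin_coeff \<alpha> k" and "b = const_coeff \<alpha> k"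
  define N where "N = b * b + a * b - \<alpha> * a * a"
  have N: "N \<noteq> 0"
    using coeff_norm_nonzero[OF assms(1)] by (simp add: N_def a_def b_def)
  have eqs: "c * b + d * (\<alpha> * a * lin_coeff \<alpha> m + b * const_coeff \<alpha> m) = 0"
    "c * a + d * (a * lin_coeff \<alpha> m + a * const_coeff \<alpha> m + b * lin_coeff \<alpha> m) = 0"
    using const lin by (simp_all add: coeff_add a_def b_def)
  \<comment> \<open>This combination of the two equations eliminates c; what is left carries the
    determinant \<open>N\<close> of R^k as a factor.\<close>
  have "d * lin_coeff \<alpha> m * N
    = b * (c * a + d * (a * lin_coeff \<alpha> m + a * const_coeff \<alpha> m + b * lin_coeff \<alpha> m))
      - a * (c * b + d * (\<alpha> * a * lin_coeff \<alpha> m + b * const_coeff \<alpha> m))"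
    by (simp add: N_def algebra_simps)
  then have "d * lin_coeff \<alpha> m = 0"
    using eqs N by simp
  then show d0: "d = 0"
    using d assms(1) by auto
  have "c * N = (c * b) * (b + a) - \<alpha> * a * (c * a)"
    by (simp add: N_def algebra_simps)
  moreover have "c * b = 0" "c * a = 0"
    using eqs d0 by simp_all
  ultimately show "c = 0"
    using N by simp
qed


section \<open>Finite fields\<close>

text \<open>Multiplication by x \<noteq> 0 permutes the nonzero elements, so their product is
  unchanged by the factor x^(q-1).\<close>

lemma power_card_eq_same:
  fixes x :: "'k::field"
  assumes "finite (UNIV :: 'k set)"
  shows "x ^ CARD('k) = x"
proof (cases "x = 0")
  case True
  then show ?thesis using assms by (simp add: finite_UNIV_card_ge_0)
next
  case False
  let ?U = "UNIV - {0 :: 'k}"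
  have "(\<Prod>y\<in>?U. x * y) = \<Prod>?U"
    by (rule prod.reindex_bij_witness[where i = "\<lambda>y. inverse x * y" and j = "\<lambda>y. x * y"])
       (use False in \<open>auto simp: field_simps\<close>)
  moreover have "\<Prod>?U \<noteq> 0" using assms by (simp add: prod_zero_iff)
  ultimately have "x ^ card ?U = 1" by (simp add: prod.distrib)
  moreover have "CARD('k) = Suc (card ?U)"
    using assms card_Suc_Diff1[of UNIV "0 :: 'k"] by simp
  ultimately show ?thesis by (simp only: power_Suc mult_1_right)
qed

text \<open>Translation by 1 permutes the field, so adding 1 to each of the q elements does not
  change their sum.\<close>

lemma of_nat_card_eq_0:
  assumes "finite (UNIV :: 'k::field set)"
  shows "of_nat CARD('k) = (0 :: 'k)"
proof -
  have "(\<Sum>x\<in>(UNIV :: 'k set). x + 1) = (\<Sum>x\<in>UNIV. x)"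
    by (rule sum.reindex_bij_witness[where i = "\<lambda>x. x - 1" and j = "\<lambda>x. x + 1"]) auto
  then show ?thesis by (simp add: sum.distrib)
qed

lemma two_le_card_field:
  assumes "finite (UNIV :: 'k::field set)"
  shows "2 \<le> CARD('k)"
proof -
  have "card {0, 1 :: 'k} \<le> CARD('k)" using assms by (intro card_mono) auto
  then show ?thesis by simp
qed

text \<open>Both sides are monic with the \<open>q\<close> elements of the base field as roots.\<close>

lemma power_card_minus_self_eq_prod:
  fixes x :: "'k::field alg_closure"
  assumes fin: "finite (UNIV :: 'k set)"
  shows "x ^ CARD('k) - x = (\<Prod>c\<in>UNIV. x - to_ac (c :: 'k))"
proof -
  define A where "A = range (to_ac :: 'k \<Rightarrow> _)"
  define f :: "'k alg_closure poly" where "f = monom 1 CARD('k) - [:0, 1:]"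
  define g where "g = (\<Prod>c\<in>A. [:- c, 1:])"
  have A: "finite A" "card A = CARD('k)"
    using fin by (auto simp: A_def card_image inj_to_ac)
  have deg_g: "degree g = CARD('k)"
    by (simp add: g_def degree_prod_eq_sum_degree A(2))
  have lead_g: "lead_coeff g = 1"
    unfolding g_def lead_coeff_prod by simp
  have "f - g = 0"
  proof (rule ccontr)
    assume ne: "f - g \<noteq> 0"
    have q: "2 \<le> CARD('k)" by (rule two_le_card_field[OF fin])
    have "coeff (f - g) CARD('k) = 0"
      using deg_g lead_g q by (auto simp: f_def coeff_pCons split: nat.splits)
    moreover have "degree (f - g) \<le> CARD('k)"
      using deg_g q by (auto simp: f_def intro!: degree_diff_le order.trans[OF degree_monom_le])
    ultimately have "degree (f - g) < CARD('k)"
      using ne by (metis leading_coeff_0_iff order_le_less)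
    moreover have "A \<subseteq> {y. poly (f - g) y = 0}"
    proof
      fix y assume "y \<in> A"
      then obtain c :: 'k where y: "y = to_ac c" by (auto simp: A_def)
      have "poly f y = to_ac (c ^ CARD('k) - c)"
        by (simp add: f_def poly_monom y)
      moreover have "poly g y = 0"
        using A(1) \<open>y \<in> A\<close> by (auto simp: g_def poly_prod prod_zero_iff)
      ultimately show "y \<in> {y. poly (f - g) y = 0}"
        by (simp add: power_card_eq_same[OF fin])
    qed
    then have "card A \<le> card {y. poly (f - g) y = 0}"
      using ne by (intro card_mono poly_roots_finite) auto
    ultimately show False
      using card_poly_roots_bound[OF ne] A(2) by simp
  qed
  then have "poly f x = poly g x" by simp
  moreover have "poly g x = (\<Prod>c\<in>UNIV. x - to_ac (c :: 'k))"
    by (simp add: g_def A_def poly_prod prod.reindex inj_to_ac)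
  ultimately show ?thesis
    by (simp add: f_def poly_monom)
qed

text \<open>
  The Frobenius conjugate of a root \<open>r\<close> outside the base field is the other root \<open>1 - r\<close>. With
  \<open>F x = x\<^sup>q - x\<close>, the product formula gives \<open>F (1 - r) = - F r\<close>, and then
  \<open>r\<^sup>q (1 - r)\<^sup>q = (-\<alpha>)\<^sup>q = -\<alpha>\<close> forces \<open>F r = 1 - 2 r\<close>.
\<close>

lemma power_card_conjugate:
  fixes r :: "'k::field alg_closure"
  assumes fin: "finite (UNIV :: 'k set)"
    and r: "r * r = r + to_ac \<alpha>" and notin: "r \<notin> range to_ac"
  shows "r ^ CARD('k) = 1 - r"
proof -
  let ?q = "CARD('k)"
  define F where "F x = x ^ ?q - x" for x :: "'k alg_closure"
  have F_prod: "F x = (\<Prod>c\<in>UNIV. x - to_ac (c :: 'k))" for x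
    by (simp add: F_def power_card_minus_self_eq_prod[OF fin])
  \<comment> \<open>Deriving this from c^q = c covers characteristic 2 as well.\<close>
  have minus_one: "(- 1) ^ ?q = (- 1 :: 'k alg_closure)"
    using arg_cong[OF power_card_eq_same[OF fin, of "- 1"], of to_ac] by simp
  have "F (1 - r) = (\<Prod>c\<in>UNIV. - 1 * (r - to_ac (c :: 'k)))"
    unfolding F_prod
    by (rule prod.reindex_bij_witness[where i = "\<lambda>c. 1 - c" and j = "\<lambda>c. 1 - c"]) auto
  also have "\<dots> = - F r"
    unfolding F_prod prod.distrib by (simp add: minus_one)
  finally have F_conj: "F (1 - r) = - F r" .
  have prod_roots: "r * (1 - r) = to_ac (- \<alpha>)"
    using r by (simp add: algebra_simps)
  have "(1 - r) ^ ?q = 1 - r - F r" "r ^ ?q = r + F r"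
    using F_conj by (simp_all add: F_def algebra_simps)
  then have "(r + F r) * (1 - r - F r) = r ^ ?q * (1 - r) ^ ?q"
    by simp
  also have "\<dots> = to_ac ((- \<alpha>) ^ ?q)"
    using prod_roots by (simp flip: power_mult_distrib)
  also have "\<dots> = r * (1 - r)"
    by (simp only: power_card_eq_same[OF fin] prod_roots)
  finally have "F r * (1 - 2 * r - F r) = 0"
    by (simp add: algebra_simps)
  moreover have "F r \<noteq> 0"
    using fin notin unfolding F_prod by (auto simp: prod_zero_iff)
  ultimately have "1 - 2 * r - F r = 0" by simp
  then show ?thesis
    by (simp add: F_def algebra_simps)
qed


section \<open>Roots of the characteristic polynomial\<close>

lemma factorization_roots:
  assumes "map_poly to_ac [:- \<alpha>, - 1, 1:] = [:- r\<^sub>1, 1:] * [:- r\<^sub>2, 1:]"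
  shows "r\<^sub>1 + r\<^sub>2 = 1" "r\<^sub>1 * r\<^sub>2 = - to_ac \<alpha>"
    "r\<^sub>1 * r\<^sub>1 = r\<^sub>1 + to_ac \<alpha>" "r\<^sub>2 * r\<^sub>2 = r\<^sub>2 + to_ac \<alpha>"
proof -
  have "[:- to_ac \<alpha>, - 1, 1:] = [:- r\<^sub>1, 1:] * [:- r\<^sub>2, 1:]"
    using assms by (simp add: map_poly_pCons)
  then have "- to_ac \<alpha> = r\<^sub>1 * r\<^sub>2" "- 1 = - r\<^sub>1 - r\<^sub>2"
    by (simp_all add: algebra_simps)
  then show sum: "r\<^sub>1 + r\<^sub>2 = 1" and prod: "r\<^sub>1 * r\<^sub>2 = - to_ac \<alpha>"
    by (simp_all add: algebra_simps)
  have "r\<^sub>2 = 1 - r\<^sub>1" using sum by (simp add: algebra_simps)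
  with prod show "r\<^sub>1 * r\<^sub>1 = r\<^sub>1 + to_ac \<alpha>"
    by (simp add: algebra_simps)
  have "r\<^sub>1 = 1 - r\<^sub>2" using sum by (simp add: algebra_simps)
  with prod show "r\<^sub>2 * r\<^sub>2 = r\<^sub>2 + to_ac \<alpha>"
    by (simp add: algebra_simps)
qed

text \<open>Together with \<open>root_power_eq\<close> at two distinct roots, this recovers the
  coefficients of R^n from the powers of the roots.\<close>

lemma two_points_determine_line:
  fixes a b c d r s :: "'k::field"
  assumes "a * r + b = c * r + d" "a * s + b = c * s + d" "r \<noteq> s"
  shows "a = c" "b = d"
proof -
  have "(a - c) * (r - s) = (a * r + b) - (a * s + b) - ((c * r + d) - (c * s + d))"
    by (simp add: algebra_simps)
  also have "\<dots> = 0" using assms by simp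
  finally show "a = c" using assms(3) by simp
  then show "b = d" using assms by simp
qed

context
  fixes \<alpha> :: "'k::field" and r\<^sub>1 r\<^sub>2 :: "'k alg_closure"
  assumes fin: "finite (UNIV :: 'k set)"
    and fact: "map_poly to_ac [:- \<alpha>, - 1, 1:] = [:- r\<^sub>1, 1:] * [:- r\<^sub>2, 1:]"
begin

text \<open>Both roots are fixed by the q-th power, so R^q = R.\<close>

lemma coeff_card_distinct_roots:
  assumes "r\<^sub>1 \<noteq> r\<^sub>2" "r\<^sub>1 \<in> range to_ac" "r\<^sub>2 \<in> range to_ac"
  shows "lin_coeff \<alpha> CARD('k) = 1" "const_coeff \<alpha> CARD('k) = 0"
proof -
  obtain s\<^sub>1 s\<^sub>2 where s: "r\<^sub>1 = to_ac s\<^sub>1" "r\<^sub>2 = to_ac s\<^sub>2"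
    using assms by auto
  note roots = factorization_roots(3,4)[OF fact]
  have "s\<^sub>1 * s\<^sub>1 = s\<^sub>1 + \<alpha>" "s\<^sub>2 * s\<^sub>2 = s\<^sub>2 + \<alpha>"
    using roots unfolding s to_ac_mult[symmetric] to_ac_add[symmetric] to_ac_eq_iff .
  then have line: "lin_coeff \<alpha> CARD('k) * s\<^sub>1 + const_coeff \<alpha> CARD('k) = 1 * s\<^sub>1 + 0"
    "lin_coeff \<alpha> CARD('k) * s\<^sub>2 + const_coeff \<alpha> CARD('k) = 1 * s\<^sub>2 + 0"
    using root_power_eq[of _ \<alpha> "CARD('k)"] by (simp_all add: power_card_eq_same[OF fin])
  have "s\<^sub>1 \<noteq> s\<^sub>2" using assms(1) s by auto
  from two_points_determine_line[OF line this]
  show "lin_coeff \<alpha> CARD('k) = 1" "const_coeff \<alpha> CARD('k) = 0" .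
qed

text \<open>Here R = r + N with N^2 = 0, so R^n = r^n + n r^(n-1) N. For n = q the factor n vanishes
  in the field, which leaves R^q = r^q = r.\<close>

lemma coeff_card_double_root:
  assumes "r\<^sub>1 = r\<^sub>2" "r\<^sub>1 \<in> range to_ac" "\<alpha> \<noteq> 0"
  obtains r where "2 * r = 1" "r * r = - \<alpha>" "r \<noteq> 0"
    "lin_coeff \<alpha> CARD('k) = 0" "const_coeff \<alpha> CARD('k) = r"
proof -
  obtain r where r: "r\<^sub>1 = to_ac r" using assms by auto
  have "to_ac (r + r) = to_ac 1" "to_ac (r * r) = to_ac (- \<alpha>)"
    using factorization_roots(1,2)[OF fact] by (simp_all add: r flip: assms(1))
  then have rr: "r + r = 1" "r * r = - \<alpha>"
    by (simp_all only: to_ac_eq_iff)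
  then have r2: "2 * r = 1" and r0: "r \<noteq> 0"
    using assms(3) by auto
  have \<alpha>: "\<alpha> = - (r * r)" using rr by simp
  \<comment> \<open>Multiplying by r avoids the exponent n - 1, which would be truncated at n =
    0.\<close>
  have coeffs: "lin_coeff \<alpha> n * r = of_nat n * r ^ n \<and> const_coeff \<alpha> n = (1 - of_nat n) * r ^ n" for n
  proof (induction n)
    case (Suc n)
    have "lin_coeff \<alpha> (Suc n) * r = lin_coeff \<alpha> n * r + const_coeff \<alpha> n * r"
      by (simp add: algebra_simps)
    also have "\<dots> = of_nat n * r ^ n * (r + r) + (1 - of_nat n) * r ^ n * r"
      using Suc by (simp add: rr)
    finally have "lin_coeff \<alpha> (Suc n) * r = of_nat (Suc n) * r ^ Suc n"
      by (simp add: algebra_simps)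
    moreover have "const_coeff \<alpha> (Suc n) = - r * (lin_coeff \<alpha> n * r)"
      by (simp add: \<alpha>)
    then have "const_coeff \<alpha> (Suc n) = (1 - of_nat (Suc n)) * r ^ Suc n"
      using Suc by (simp add: algebra_simps)
    ultimately show ?case by blast
  qed simp
  have "lin_coeff \<alpha> CARD('k) = 0" "const_coeff \<alpha> CARD('k) = r"
    using coeffs[of "CARD('k)"] r0
    by (simp_all add: of_nat_card_eq_0[OF fin] power_card_eq_same[OF fin])
  with that r2 rr r0 show ?thesis by blast
qed

text \<open>The q-th power swaps the two roots, so R^q = 1 - R; the coefficients are found in the
  algebraic closure and pulled back along the injective \<open>to_ac\<close>.\<close>

lemma coeff_card_conjugate_roots:
  assumes "r\<^sub>1 \<notin> range to_ac" "r\<^sub>2 \<notin> range to_ac"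
  shows "lin_coeff \<alpha> CARD('k) = - 1" "const_coeff \<alpha> CARD('k) = 1"
proof -
  note roots = factorization_roots[OF fact]
  have conj: "r\<^sub>1 ^ CARD('k) = 1 - r\<^sub>1" "r\<^sub>2 ^ CARD('k) = 1 - r\<^sub>2"
    using power_card_conjugate[OF fin] roots assms by blast+
  \<comment> \<open>A double root would satisfy r^q = 1 - r = r and hence lie in the base
    field.\<close>
  have "r\<^sub>1 \<noteq> r\<^sub>2"
  proof
    assume "r\<^sub>1 = r\<^sub>2"
    then have "r\<^sub>1 ^ CARD('k) - r\<^sub>1 = 0" unfolding conj(1) using roots(1) by simp
    then show False
      using assms(1) fin by (auto simp: power_card_minus_self_eq_prod prod_zero_iff)
  qed
  have line: "lin_coeff (to_ac \<alpha>) CARD('k) * r + const_coeff (to_ac \<alpha>) CARD('k) = - 1 * r + 1"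
    if "r ^ CARD('k) = 1 - r" "r * r = r + to_ac \<alpha>" for r
    using root_power_eq[OF that(2), of "CARD('k)"] that(1) by simp
  have "lin_coeff (to_ac \<alpha>) CARD('k) = - 1" "const_coeff (to_ac \<alpha>) CARD('k) = 1"
    by (rule two_points_determine_line[OF line[OF conj(1) roots(3)] line[OF conj(2) roots(4)]
          \<open>r\<^sub>1 \<noteq> r\<^sub>2\<close>])+
  then have "to_ac (lin_coeff \<alpha> CARD('k)) = to_ac (- 1)" "to_ac (const_coeff \<alpha> CARD('k)) = to_ac 1"
    by (simp_all add: to_ac_coeff)
  then show "lin_coeff \<alpha> CARD('k) = - 1" "const_coeff \<alpha> CARD('k) = 1"
    by (simp_all only: to_ac_eq_iff)
qed

end


section \<open>Linear independence of monomial functions\<close>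

text \<open>Induction on the set \<open>V\<close> of variables. In a single variable x the sum is a
  polynomial that vanishes on the whole field, of degree below q if the field is finite. So its
  coefficients vanish, and they are relations in the remaining variables. \<open>CARD\<close> of an
  infinite type is 0, hence the separate disjunct for infinite fields.\<close>

lemma monomials_independent_aux:
  fixes c :: "'a multiset \<Rightarrow> 'k::field"
  assumes "finite V" "finite S" "\<And>M. M \<in> S \<Longrightarrow> set_mset M \<subseteq> V"
    and "\<And>M j. M \<in> S \<Longrightarrow> infinite (UNIV :: 'k set) \<or> count M j < CARD('k)"
    and "\<And>t. (\<Sum>M\<in>S. c M * (\<Prod>j\<in>#M. t j)) = 0"
    and "M \<in> S"
  shows "c M = 0"
  using assms
proof (induction V arbitrary: S c M rule: finite_induct)
  case empty
  then have "S = {{#}}" by (auto simp: set_mset_eq_empty_iff)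
  with empty.prems(4)[of "\<lambda>_. 1"] empty.prems(5) show ?case by simp
next
  case (insert x V)
  define rest where "rest M = filter_mset (\<lambda>j. j \<noteq> x) M" for M :: "'a multiset"
  have split: "rest M + replicate_mset (count M x) x = M" for M
    unfolding rest_def using multiset_partition[of M "\<lambda>j. j \<noteq> x"]
    by (simp add: filter_eq_replicate_mset)
  have coeffs: "(\<Sum>M | M \<in> S \<and> count M x = k. c M * (\<Prod>j\<in>#rest M. t j)) = 0" for k t
  proof -
    define p where "p = (\<Sum>M\<in>S. monom (c M * (\<Prod>j\<in>#rest M. t j)) (count M x))"
    have "poly p s = 0" for s
    proof -
      let ?t = "t(x := s)"
      have "(\<Prod>j\<in>#M. ?t j) = (\<Prod>j\<in>#rest M. t j) * s ^ count M x" for M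
      proof -
        have "(\<Prod>j\<in>#M. ?t j) = (\<Prod>j\<in>#rest M + replicate_mset (count M x) x. ?t j)"
          by (simp only: split)
        moreover have "(\<Prod>j\<in>#rest M. ?t j) = (\<Prod>j\<in>#rest M. t j)"
          by (intro arg_cong[where f = prod_mset] image_mset_cong) (auto simp: rest_def)
        ultimately show ?thesis by simp
      qed
      then show ?thesis
        using insert.prems(4)[of ?t] by (simp add: p_def poly_sum poly_monom mult.assoc)
    qed
    then have roots: "{s. poly p s = 0} = UNIV" by auto
    have "p = 0"
    proof (rule ccontr)
      assume "p \<noteq> 0"
      then have fin: "finite (UNIV :: 'k set)"
        using poly_roots_finite[of p] roots by simp
      have "degree p \<le> CARD('k) - 1"
        unfolding p_def
      proof (rule degree_sum_le)
        fix M assume "M \<in> S"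
        then have "count M x < CARD('k)" using insert.prems(3) fin by blast
        then show "degree (monom (c M * (\<Prod>j\<in>#rest M. t j)) (count M x)) \<le> CARD('k) - 1"
          by (intro order.trans[OF degree_monom_le]) simp
      qed (rule insert.prems(1))
      moreover have "0 < CARD('k)" using fin by (simp add: finite_UNIV_card_ge_0)
      ultimately show False
        using card_poly_roots_bound[OF \<open>p \<noteq> 0\<close>] roots by simp
    qed
    then have "0 = coeff p k" by simp
    also have "\<dots> = (\<Sum>M\<in>S. if count M x = k then c M * (\<Prod>j\<in>#rest M. t j) else 0)"
      by (simp add: p_def coeff_sum)
    finally show ?thesis
      using insert.prems(1) by (simp add: sum.If_cases Int_def)
  qed
  \<comment> \<open>Monomials with the same exponent of x are determined by their other factors, so
    the induction hypothesis applies to their images under \<open>rest\<close>.\<close>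
  define k where "k = count M x"
  define S' where "S' = {M \<in> S. count M x = k}"
  have inj: "inj_on rest S'"
    by (rule inj_on_inverseI[where g = "\<lambda>M. M + replicate_mset k x"])
       (use split in \<open>auto simp: S'_def\<close>)
  have "c (rest M + replicate_mset k x) = 0"
  proof (rule insert.IH[where c = "\<lambda>N. c (N + replicate_mset k x)" and S = "rest ` S'"])
    show "finite (rest ` S')" using insert.prems(1) by (simp add: S'_def)
    show "set_mset N \<subseteq> V" if "N \<in> rest ` S'" for N
      using that insert.prems(2) by (fastforce simp: rest_def S'_def)
    show "infinite (UNIV :: 'k set) \<or> count N j < CARD('k)" if N: "N \<in> rest ` S'" for N j
    proof -
      obtain M where "M \<in> S" "N = rest M" using N by (auto simp: S'_def)
      moreover from this have "count N j \<le> count M j" by (simp add: rest_def)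
      ultimately show ?thesis using insert.prems(3) by (meson le_less_trans)
    qed
    show "(\<Sum>N\<in>rest ` S'. c (N + replicate_mset k x) * (\<Prod>j\<in>#N. t j)) = 0" for t
    proof -
      have "(\<Sum>N\<in>rest ` S'. c (N + replicate_mset k x) * (\<Prod>j\<in>#N. t j))
        = (\<Sum>M\<in>S'. c (rest M + replicate_mset k x) * (\<Prod>j\<in>#rest M. t j))"
        using sum.reindex[OF inj] by simp
      also have "\<dots> = (\<Sum>M\<in>S'. c M * (\<Prod>j\<in>#rest M. t j))"
        by (rule sum.cong) (use split in \<open>auto simp: S'_def\<close>)
      finally show ?thesis using coeffs by (simp add: S'_def)
    qed
    show "rest M \<in> rest ` S'" using insert.prems(5) by (simp add: S'_def k_def)
  qed
  then show ?case by (simp add: k_def split)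
qed

lemma monomials_independent:
  fixes c :: "'a multiset \<Rightarrow> 'k::field"
  assumes "finite S"
    and "\<And>M j. M \<in> S \<Longrightarrow> infinite (UNIV :: 'k set) \<or> count M j < CARD('k)"
    and "\<And>t. (\<Sum>M\<in>S. c M * (\<Prod>j\<in>#M. t j)) = 0"
    and "M \<in> S"
  shows "c M = 0"
  by (rule monomials_independent_aux[where V = "\<Union>(set_mset ` S)" and S = S])
     (use assms in auto)


section \<open>Evaluation of left-normed products\<close>

lemma L10_mul_nth:
  "L10_mul \<alpha> x y $ 1 = \<alpha> * x $ 2 * y $ 3"
  "L10_mul \<alpha> x y $ 2 = (x $ 1 + x $ 2) * y $ 3"
  "L10_mul \<alpha> x y $ 3 = 0"
  by (simp_all add: L10_mul_def L10_table_def sum_3 axis_def algebra_simps)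

text \<open>Right multiplication by y is y_3 R on the span of e_1 and e_2 and annihilates e_3, so an
  e_3-component survives only in the empty product.\<close>

lemma foldl_L10_mul_nth:
  fixes ys :: "('k::field ^ 3) list"
  defines "T \<equiv> (\<Prod>y\<leftarrow>ys. y $ 3)" and "n \<equiv> length ys"
  shows "foldl (L10_mul \<alpha>) x ys $ 1
      = T * (const_coeff \<alpha> n * x $ 1 + \<alpha> * lin_coeff \<alpha> n * x $ 2)"
    "foldl (L10_mul \<alpha>) x ys $ 2
      = T * (lin_coeff \<alpha> n * x $ 1 + (lin_coeff \<alpha> n + const_coeff \<alpha> n) * x $ 2)"
    "foldl (L10_mul \<alpha>) x ys $ 3 = (if ys = [] then x $ 3 else 0)"
  unfolding T_def n_def
  by (induction ys rule: rev_induct) (simp_all add: L10_mul_nth algebra_simps)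

interpretation L10: leibniz_algebra "(*s)" "L10_mul (\<alpha> :: 'k::field)" for \<alpha>
  by (rule leibniz_algebra_L10)

abbreviation L10_eval :: "'k::field \<Rightarrow> (nat \<Rightarrow> 'k ^ 3) \<Rightarrow> 'k free_leibniz \<Rightarrow> 'k ^ 3" where
  "L10_eval \<alpha> a \<equiv> fl_eval (*s) (L10_mul \<alpha>) a"

lemma (in leibniz_algebra) fl_eval_minus: "fl_eval scl mul a (- f) = - fl_eval scl mul a f"
  using fl_eval_add[of a f "- f"] fl_eval_zero[of a] by (simp add: eq_neg_iff_add_eq_0 add.commute)

lemma (in leibniz_algebra) fl_eval_diff:
  "fl_eval scl mul a (f - g) = fl_eval scl mul a f - fl_eval scl mul a g"
  using fl_eval_add[of a f "- g"] by (simp add: fl_eval_minus)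

lemma (in leibniz_algebra) fl_eval_sum:
  "fl_eval scl mul a (sum f A) = (\<Sum>x\<in>A. fl_eval scl mul a (f x))"
  by (induction A rule: infinite_finite_induct) (simp_all add: fl_eval_zero fl_eval_add)

lemma (in leibniz_algebra) fl_eval_foldl:
  "fl_eval scl mul a (foldl (*) u vs) = foldl mul (fl_eval scl mul a u) (map (fl_eval scl mul a) vs)"
  by (induction vs rule: rev_induct) (simp_all add: fl_eval_mul)

lemma rmul_pow_conv_foldl: "rmul_pow x y m = foldl (*) x (replicate m y)"
proof -
  have "foldl (*) (u * y) (replicate m y) = foldl (*) u (replicate m y) * y" for u m
    by (induction m arbitrary: u) simp_all
  then show ?thesis
    unfolding rmul_pow_def by (induction m) simp_all
qed

definition normed_monomial :: "nat \<Rightarrow> nat multiset \<Rightarrow> 'k::field free_leibniz" where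
  "normed_monomial i M = foldl (*) (gen i) (map gen (sorted_list_of_multiset M))"

text \<open>A head other than x_i goes to a multiple of e_3 and contributes nothing to the first two
  coordinates, so the substitution isolates the monomials with head x_i.\<close>

lemma L10_eval_normed_monomial:
  fixes t :: "nat \<Rightarrow> 'k::field" and i :: nat
  defines "a \<equiv> \<lambda>j. t j *s axis 3 1 + (if j = i then axis 1 1 else 0)"
  shows "L10_eval \<alpha> a (normed_monomial j M) $ 1
      = (if j = i then (\<Prod>j\<in>#M. t j) * const_coeff \<alpha> (size M) else 0)"
    "L10_eval \<alpha> a (normed_monomial j M) $ 2
      = (if j = i then (\<Prod>j\<in>#M. t j) * lin_coeff \<alpha> (size M) else 0)"
proof -
  have a: "a j $ 1 = (if j = i then 1 else 0)" "a j $ 2 = 0" "a j $ 3 = t j" for j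
    by (simp_all add: a_def axis_def)
  have "(\<Prod>j\<leftarrow>sorted_list_of_multiset M. t j) = (\<Prod>j\<in>#M. t j)"
    by (metis mset_map mset_sorted_list_of_multiset prod_mset_prod_list)
  moreover have "length (sorted_list_of_multiset M) = size M"
    by (metis mset_sorted_list_of_multiset size_mset)
  ultimately show "L10_eval \<alpha> a (normed_monomial j M) $ 1
      = (if j = i then (\<Prod>j\<in>#M. t j) * const_coeff \<alpha> (size M) else 0)"
    "L10_eval \<alpha> a (normed_monomial j M) $ 2
      = (if j = i then (\<Prod>j\<in>#M. t j) * lin_coeff \<alpha> (size M) else 0)"
    by (simp_all add: normed_monomial_def L10.fl_eval_foldl L10.fl_eval_gen
        foldl_L10_mul_nth a o_def)
qed


section \<open>Independence of the normal monomials\<close>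

text \<open>
  The normal form of a monomial \<open>x\<^sub>i M\<close> has all exponents in \<open>M\<close> below \<open>q\<close>, up to a further
  power \<open>q - 1\<close> of the generator of least index in \<open>M\<close>, which the flag \<open>e\<close> records. That power acts
  as \<open>R\<^sup>q\<^sup>-\<^sup>1\<close>; when this is a scalar (\<open>const_coeff \<alpha> q = 0\<close>), only \<open>e = False\<close> occurs. For
  infinite \<open>K\<close> all exponents are normal.
\<close>

definition normal_monomial :: "nat \<times> nat multiset \<times> bool \<Rightarrow> 'k::field free_leibniz" where
  "normal_monomial = (\<lambda>(i, M, e).
     normed_monomial i (if e then M + replicate_mset (CARD('k) - 1) (Min_mset M) else M))"

definition normal_index :: "'k::field \<Rightarrow> (nat \<times> nat multiset \<times> bool) set" where
  "normal_index \<alpha> = {(i, M, e). (\<forall>j. infinite (UNIV :: 'k set) \<or> count M j < CARD('k)) \<and>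
     (e \<longrightarrow> M \<noteq> {#} \<and> finite (UNIV :: 'k set) \<and> const_coeff \<alpha> CARD('k) \<noteq> 0)}"

lemma L10_eval_normal_monomial:
  fixes t :: "nat \<Rightarrow> 'k::field" and i :: nat
  defines "a \<equiv> \<lambda>j. t j *s axis 3 1 + (if j = i then axis 1 1 else 0)"
  assumes "(j, M, e) \<in> normal_index \<alpha>"
  shows "L10_eval \<alpha> a (normal_monomial (j, M, e)) $ 1 = (if j = i
      then (\<Prod>j\<in>#M. t j) * const_coeff \<alpha> (size M + (if e then CARD('k) - 1 else 0)) else 0)"
    "L10_eval \<alpha> a (normal_monomial (j, M, e)) $ 2 = (if j = i
      then (\<Prod>j\<in>#M. t j) * lin_coeff \<alpha> (size M + (if e then CARD('k) - 1 else 0)) else 0)"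
proof -
  \<comment> \<open>The least index occurs in \<open>M\<close>, so t t^(q-1) = t absorbs the added
    power; only the exponent of R grows.\<close>
  have "(\<Prod>j\<in>#M + replicate_mset (CARD('k) - 1) (Min_mset M). t j) = (\<Prod>j\<in>#M. t j)" if e
  proof -
    let ?m = "Min_mset M"
    have fin: "finite (UNIV :: 'k set)" and "M \<noteq> {#}"
      using assms(2) that by (auto simp: normal_index_def)
    then obtain N where N: "M = add_mset ?m N"
      by (metis Min_in finite_set_mset multi_member_split set_mset_eq_empty_iff)
    have "0 < CARD('k)" using fin by (simp add: finite_UNIV_card_ge_0)
    then have "t ?m * t ?m ^ (CARD('k) - 1) = t ?m"
      using power_card_eq_same[OF fin, of "t ?m"] by (metis power_eq_if gr_implies_not0)
    moreover have "(\<Prod>j\<in>#M. t j) = t ?m * (\<Prod>j\<in>#N. t j)"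
      by (subst N) simp
    ultimately show ?thesis by (simp add: mult_ac)
  qed
  then show "L10_eval \<alpha> a (normal_monomial (j, M, e)) $ 1 = (if j = i
      then (\<Prod>j\<in>#M. t j) * const_coeff \<alpha> (size M + (if e then CARD('k) - 1 else 0)) else 0)"
    "L10_eval \<alpha> a (normal_monomial (j, M, e)) $ 2 = (if j = i
      then (\<Prod>j\<in>#M. t j) * lin_coeff \<alpha> (size M + (if e then CARD('k) - 1 else 0)) else 0)"
    unfolding a_def by (simp_all add: normal_monomial_def L10_eval_normed_monomial)
qed

text \<open>For a fixed head x_i the first two coordinates are polynomial functions of t that
  vanish. Independence of monomials leaves, for each \<open>M\<close>, two equations in the
  coefficients with flags \<open>False\<close> and \<open>True\<close>, which
  \<open>coeff_independent\<close> solves.\<close>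

lemma normal_monomials_independent:
  fixes \<alpha> :: "'k::field"
  assumes "\<alpha> \<noteq> 0" and J: "finite J" "J \<subseteq> normal_index \<alpha>"
    and ident: "(\<Sum>x\<in>J. c x *\<^sub>F normal_monomial x) \<in> identities (*s) (L10_mul \<alpha>)"
    and "x \<in> J"
  shows "c x = 0"
proof -
  obtain i M e where x: "x = (i, M, e)" by (cases x) auto
  define d where "d y = (if y \<in> J then c y else 0)" for y
  define Ms where "Ms = {M. \<exists>e. (i, M, e) \<in> J}"
  let ?m = "CARD('k) - 1"
  have "Ms \<subseteq> (fst \<circ> snd) ` J" by (force simp: Ms_def)
  then have Ms: "finite Ms" using J(1) finite_surj by blast
  have M: "M \<in> Ms" using \<open>x \<in> J\<close> by (auto simp: Ms_def x)
  \<comment> \<open>Stated for arbitrary \<open>f\<close> to serve both \<open>const_coeff\<close>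
    and \<open>lin_coeff\<close>; terms with another head drop out.\<close>
  have collect: "(\<Sum>M\<in>Ms. (d (i, M, False) * f (size M) + d (i, M, True) * f (size M + ?m))
      * (\<Prod>j\<in>#M. t j)) = 0"
    if J_sum: "(\<Sum>(j, M, e)\<in>J. c (j, M, e) * (if j = i
      then (\<Prod>j\<in>#M. t j) * f (size M + (if e then ?m else 0)) else 0)) = 0"
    for t and f :: "nat \<Rightarrow> 'k"
  proof -
    let ?g = "\<lambda>j M e. (\<Prod>j\<in>#M. t j) * f (size M + (if e then ?m else 0))"
    note J_sum[symmetric]
    also have "(\<Sum>(j, M, e)\<in>J. c (j, M, e) * (if j = i then ?g j M e else 0))
      = (\<Sum>(j, M, e)\<in>{i} \<times> Ms \<times> UNIV. d (j, M, e) * ?g j M e)"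
      by (rule sum.mono_neutral_cong) (use Ms J(1) in \<open>auto simp: d_def Ms_def split: if_splits\<close>)
    also have "\<dots> = (\<Sum>M\<in>Ms. \<Sum>e\<in>UNIV. d (i, M, e) * ?g i M e)"
      by (simp only: sum.cartesian_product[symmetric] sum.insert[OF finite.emptyI] sum.empty
          empty_iff not_False_eq_True add_0_right)
    also have "\<dots> = (\<Sum>M\<in>Ms. (d (i, M, False) * f (size M) + d (i, M, True) * f (size M + ?m))
      * (\<Prod>j\<in>#M. t j))"
      by (rule sum.cong) (simp_all add: UNIV_bool algebra_simps)
    finally show ?thesis by simp
  qed
  have zero: "(\<Sum>y\<in>J. c y * L10_eval \<alpha> a (normal_monomial y) $ k) = 0" for a k
  proof -
    have "L10_eval \<alpha> a (\<Sum>y\<in>J. c y *\<^sub>F normal_monomial y) $ k = 0"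
      using ident by (simp add: identities_def)
    then show ?thesis by (simp add: L10.fl_eval_sum L10.fl_eval_scale)
  qed
  have const_sum: "(\<Sum>M\<in>Ms. (d (i, M, False) * const_coeff \<alpha> (size M)
      + d (i, M, True) * const_coeff \<alpha> (size M + ?m)) * (\<Prod>j\<in>#M. t j)) = 0"
    and lin_sum: "(\<Sum>M\<in>Ms. (d (i, M, False) * lin_coeff \<alpha> (size M)
      + d (i, M, True) * lin_coeff \<alpha> (size M + ?m)) * (\<Prod>j\<in>#M. t j)) = 0" for t
  proof -
    let ?a = "\<lambda>j. t j *s axis 3 1 + (if j = i then axis 1 1 else 0)"
    show "(\<Sum>M\<in>Ms. (d (i, M, False) * const_coeff \<alpha> (size M)
      + d (i, M, True) * const_coeff \<alpha> (size M + ?m)) * (\<Prod>j\<in>#M. t j)) = 0"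
      by (rule collect, rule trans[OF sum.cong zero[of ?a 1]])
        (use J(2) in \<open>auto simp: L10_eval_normal_monomial\<close>)
    show "(\<Sum>M\<in>Ms. (d (i, M, False) * lin_coeff \<alpha> (size M)
      + d (i, M, True) * lin_coeff \<alpha> (size M + ?m)) * (\<Prod>j\<in>#M. t j)) = 0"
      by (rule collect, rule trans[OF sum.cong zero[of ?a 2]])
        (use J(2) in \<open>auto simp: L10_eval_normal_monomial\<close>)
  qed
  have exponents: "infinite (UNIV :: 'k set) \<or> count M j < CARD('k)" if "M \<in> Ms" for M j
    using that J(2) by (auto simp: Ms_def normal_index_def)
  note eqs = monomials_independent[OF Ms exponents const_sum M]
    monomials_independent[OF Ms exponents lin_sum M]
  \<comment> \<open>For a finite field \<open>Suc ?m\<close> is q, so this is the condition that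
    \<open>normal_index\<close> puts on flagged indices.\<close>
  have "d (i, M, True) = 0 \<or> const_coeff \<alpha> (Suc ?m) \<noteq> 0"
  proof (cases "(i, M, True) \<in> J")
    case True
    then have "finite (UNIV :: 'k set)" "const_coeff \<alpha> CARD('k) \<noteq> 0"
      using J(2) by (auto simp: normal_index_def)
    then show ?thesis by (simp add: finite_UNIV_card_ge_0)
  qed (simp add: d_def)
  from coeff_independent[OF assms(1) this eqs]
  have "d (i, M, e) = 0" by (cases e) simp_all
  then show ?thesis using \<open>x \<in> J\<close> by (simp add: d_def x)
qed


section \<open>\<open>T\<close>-ideals\<close>

lemma T_ideal_subst:
  assumes "T_ideal I" "f \<in> I"
  shows "fl_eval scale_fl (*) a f \<in> I"
  using assms fl.algebra_hom_fl_eval unfolding T_ideal_def by blast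

text \<open>Both sides are homomorphisms that agree on the generators. Hence identities are stable
  under endomorphisms.\<close>

lemma (in leibniz_algebra) fl_eval_hom:
  assumes "algebra_hom scale_fl (*) scale_fl (*) \<phi>"
  shows "fl_eval scl mul a (\<phi> f) = fl_eval scl mul (\<lambda>i. fl_eval scl mul a (\<phi> (gen i))) f"
proof -
  have "algebra_hom scale_fl (*) scl mul (fl_eval scl mul a \<circ> \<phi>)"
    using assms algebra_hom_fl_eval[of a] unfolding algebra_hom_def
    by (auto intro: Vector_Spaces.linear_compose)
  moreover have "algebra_hom scale_fl (*) scl mul
      (fl_eval scl mul (\<lambda>i. fl_eval scl mul a (\<phi> (gen i))))"
    by (rule algebra_hom_fl_eval)
  ultimately have "fl_eval scl mul a \<circ> \<phi> = fl_eval scl mul (\<lambda>i. fl_eval scl mul a (\<phi> (gen i)))"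
    using free_leibniz_universal[of "\<lambda>i. fl_eval scl mul a (\<phi> (gen i))"]
    by (auto simp: fl_eval_gen)
  then show ?thesis by (metis comp_apply)
qed

lemma (in leibniz_algebra) mul_zero: "mul 0 x = 0" "mul x 0 = 0"
  using mul_add_left[of 0 0 x] mul_add_right[of x 0 0] by simp_all

lemma (in leibniz_algebra) mul_diff_left: "mul (x - y) z = mul x z - mul y z"
  using mul_add_left[of "x - y" y z] by (simp add: algebra_simps)

lemma (in leibniz_algebra) T_ideal_identities: "T_ideal (identities scl mul)"
proof -
  have "fl_ideal (identities scl mul)"
    unfolding fl_ideal_def fl.subspace_def identities_def
    by (auto simp: fl_eval_zero fl_eval_add fl_eval_scale fl_eval_mul mul_zero)
  moreover have "fl_eval scl mul a (\<phi> f) = 0"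
    if "algebra_hom scale_fl (*) scale_fl (*) \<phi>" "f \<in> identities scl mul" for \<phi> f a
    using fl_eval_hom[OF that(1), of a f] that(2) by (simp add: identities_def)
  ultimately show ?thesis
    unfolding T_ideal_def by (auto simp: identities_def)
qed

lemma T_ideal_gen_subset:
  assumes "T_ideal I" "S \<subseteq> I"
  shows "T_ideal_gen S \<subseteq> I"
  unfolding T_ideal_gen_def using assms by (intro hull_minimal)

lemma subset_T_ideal_gen: "S \<subseteq> T_ideal_gen S"
  unfolding T_ideal_gen_def by (rule hull_subset)

section \<open>T-ideals containing x_1 (x_2 x_3), and spanning sets modulo them\<close>

locale right_null_T_ideal =
  fixes I :: "'k::field free_leibniz set"
  assumes T_ideal: "T_ideal I" and right_null: "x\<^sub>1 * (x\<^sub>2 * x\<^sub>3) \<in> I"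
begin

lemma subspace: "fl.subspace I"
  and ideal: "f \<in> I \<Longrightarrow> f * g \<in> I" "f \<in> I \<Longrightarrow> g * f \<in> I"
  using T_ideal by (auto simp: T_ideal_def fl_ideal_def)

lemmas ideal_add = fl.subspace_add[OF subspace]
  and ideal_diff = fl.subspace_diff[OF subspace]
  and ideal_zero = fl.subspace_0[OF subspace]

lemma mult_product_in: "u * (v * w) \<in> I"
  using T_ideal_subst[OF T_ideal right_null, of "\<lambda>i. if i = 0 then u else if i = 1 then v else w"]
  by (simp add: fl.fl_eval_mul fl.fl_eval_gen)

lemma foldl_in: "u \<in> I \<Longrightarrow> foldl (*) u vs \<in> I"
  by (induction vs rule: rev_induct) (simp_all add: ideal)

lemma foldl_diff:
  fixes u u' :: "'k free_leibniz"
  shows "foldl (*) (u - u') vs = foldl (*) u vs - foldl (*) u' vs"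
  by (induction vs rule: rev_induct) (simp_all add: fl.mul_diff_left)

text \<open>By the Leibniz identity (u v) w - (u w) v = u (v w) lies in \<open>I\<close>, so
  adjacent right factors may be exchanged.\<close>

lemma foldl_move_last: "foldl (*) (u * v) vs - foldl (*) u vs * v \<in> I"
proof (induction vs arbitrary: u)
  case (Cons w vs)
  have "foldl (*) (u * v * w) vs - foldl (*) (u * w * v) vs = foldl (*) (u * (v * w)) vs"
    by (simp add: fl.leibniz foldl_diff)
  then have "foldl (*) (u * v * w) vs - foldl (*) (u * w * v) vs \<in> I"
    by (simp add: foldl_in mult_product_in)
  from ideal_add[OF this Cons[of "u * w"]] show ?case by simp
qed (simp add: ideal_zero)

text \<open>The last factor of \<open>vs\<close> is moved to the end of \<open>ws\<close> by
  \<open>foldl_move_last\<close>; the other factors are handled by induction.\<close>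

lemma foldl_permute: "mset vs = mset ws \<Longrightarrow> foldl (*) u vs - foldl (*) u ws \<in> I"
proof (induction vs arbitrary: ws rule: rev_induct)
  case (snoc v vs)
  then obtain ws\<^sub>1 ws\<^sub>2 where ws: "ws = ws\<^sub>1 @ v # ws\<^sub>2"
    by (metis in_set_conv_decomp mset_eq_setD)
  have "mset vs = mset (ws\<^sub>1 @ ws\<^sub>2)" using snoc.prems by (simp add: ws)
  then have "(foldl (*) u vs - foldl (*) u (ws\<^sub>1 @ ws\<^sub>2)) * v \<in> I"
    by (intro ideal snoc.IH)
  moreover have "foldl (*) (foldl (*) u ws\<^sub>1 * v) ws\<^sub>2 - foldl (*) (foldl (*) u ws\<^sub>1) ws\<^sub>2 * v \<in> I"
    by (rule foldl_move_last)
  ultimately show ?case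
    using ideal_diff by (fastforce simp: ws fl.mul_diff_left)
qed (simp add: ideal_zero)

text \<open>Brings the factors \<open>js\<close> to the front of the tail, where a relation can be
  applied to them.\<close>

lemma normed_monomial_foldl:
  "foldl (*) (foldl (*) (gen i) (map gen js)) (map gen (sorted_list_of_multiset N))
     - normed_monomial i (mset js + N) \<in> I"
  using foldl_permute[of "map gen (js @ sorted_list_of_multiset N)"
      "map gen (sorted_list_of_multiset (mset js + N))" "gen i"]
  by (simp add: normed_monomial_def)

lemma normed_monomial_mult_gen: "normed_monomial i M * gen j - normed_monomial i (add_mset j M) \<in> I"
  using foldl_permute[of "map gen (sorted_list_of_multiset M @ [j])"
      "map gen (sorted_list_of_multiset (add_mset j M))" "gen i"]
  by (simp add: normed_monomial_def)

lemma normed_monomial_mult_normed_monomial: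
  assumes "N \<noteq> {#}"
  shows "f * normed_monomial i N \<in> I"
proof -
  obtain js j where "sorted_list_of_multiset N = js @ [j]"
    using assms by (metis mset_sorted_list_of_multiset mset.simps(1) rev_exhaust)
  then show ?thesis by (simp add: normed_monomial_def mult_product_in)
qed

lemma span_congruent:
  assumes "f - g \<in> I" "g \<in> fl.span (I \<union> B)"
  shows "f \<in> fl.span (I \<union> B)"
  using fl.span_add[OF fl.span_base[of "f - g" "I \<union> B"] assms(2)] assms(1) by simp

text \<open>The span contains the generators and is closed under products: right multiplication by a
  generator extends the tail, and by a longer monomial it lands in \<open>I\<close>.\<close>

lemma span_normed_monomials: "fl.span (I \<union> range (case_prod normed_monomial)) = UNIV"
proof -
  let ?D = "fl.span (I \<union> range (case_prod normed_monomial))"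
  have I: "f \<in> ?D" if "f \<in> I" for f
    using that by (intro fl.span_base) simp
  have mon: "normed_monomial i M \<in> ?D" for i M
    by (intro fl.span_base UnI2 image_eqI[where x = "(i, M)"]) simp_all
  have mon_mon: "normed_monomial i M * normed_monomial j N \<in> ?D" for i M j N
  proof (cases "N = {#}")
    case True
    then show ?thesis
      using span_congruent[OF normed_monomial_mult_gen mon] by (simp add: normed_monomial_def)
  qed (intro I normed_monomial_mult_normed_monomial)
  have mon_mult: "normed_monomial i M * g \<in> ?D" if "g \<in> ?D" for i M g
    using that
  proof (induction g rule: fl.span_induct_alt)
    case (step c f g)
    have "normed_monomial i M * f \<in> ?D"
      using step(1)
    proof
      assume "f \<in> I"
      then show ?thesis by (intro I ideal)
    next
      assume "f \<in> range (case_prod normed_monomial)"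
      then show ?thesis using mon_mon by auto
    qed
    then show ?case
      using step(2) by (simp add: fl.mul_add_right fl.mul_scale_right fl.span_add fl.span_scale)
  qed (simp add: fl.mul_zero fl.span_zero)
  have mult: "f * g \<in> ?D" if "f \<in> ?D" "g \<in> ?D" for f g
    using that(1)
  proof (induction f rule: fl.span_induct_alt)
    case (step c f h)
    have "f * g \<in> ?D"
      using step(1)
    proof
      assume "f \<in> I"
      then show ?thesis by (intro I ideal)
    next
      assume "f \<in> range (case_prod normed_monomial)"
      then show ?thesis using mon_mult[OF that(2)] by auto
    qed
    then show ?case
      using step(2) by (simp add: fl.mul_add_left fl.mul_scale_left fl.span_add fl.span_scale)
  qed (simp add: fl.mul_zero fl.span_zero)
  have "abs_free_leibniz s \<in> ?D" for s
  proof (induction s)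
    case (LVar i)
    have "(gen i :: 'k free_leibniz) = normed_monomial i {#}" by (simp add: normed_monomial_def)
    then show ?case using mon[of i "{#}"] by (simp flip: gen.abs_eq)
  next
    case LZero
    show ?case by (simp add: fl.span_zero flip: zero_free_leibniz.abs_eq)
  next
    case (LAdd s t)
    then show ?case by (simp add: fl.span_add flip: plus_free_leibniz.abs_eq)
  next
    case (LScale c s)
    then show ?case by (simp add: fl.span_scale flip: scale_fl.abs_eq)
  next
    case (LMul s t)
    then show ?case by (simp add: mult flip: times_free_leibniz.abs_eq)
  qed
  then have "f \<in> ?D" for f by (induct f rule: free_leibniz.abs_induct)
  then show ?thesis by blast
qed

end


section \<open>Reduction to normal monomials\<close>

context right_null_T_ideal
begin

lemma foldl_add_scale:
  fixes u v w :: "'k free_leibniz"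
  shows "foldl (*) (u + b *\<^sub>F v + c *\<^sub>F w) vs
    = foldl (*) u vs + b *\<^sub>F foldl (*) v vs + c *\<^sub>F foldl (*) w vs"
  by (induction vs rule: rev_induct) (simp_all add: fl.mul_add_left fl.mul_scale_left)

text \<open>Multiplied on the right by the tail \<open>N\<close>, the relation expresses the
  monomial with \<open>js\<close> through those with \<open>ks\<close> and \<open>ls\<close> modulo
  \<open>I\<close>.\<close>

lemma normed_monomial_reduce:
  assumes rel: "foldl (*) (gen i) (map gen js) + b *\<^sub>F foldl (*) (gen i) (map gen ks)
      + c *\<^sub>F foldl (*) (gen i) (map gen ls) \<in> I"
    and ks: "normed_monomial i (mset ks + N) \<in> fl.span (I \<union> B)"
    and ls: "normed_monomial i (mset ls + N) \<in> fl.span (I \<union> B)"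
  shows "normed_monomial i (mset js + N) \<in> fl.span (I \<union> B)"
proof -
  define h :: "nat list \<Rightarrow> 'k free_leibniz" where
    "h ns = foldl (*) (foldl (*) (gen i) (map gen ns)) (map gen (sorted_list_of_multiset N))" for ns
  have h: "h ns - normed_monomial i (mset ns + N) \<in> I" for ns
    unfolding h_def by (rule normed_monomial_foldl)
  have "h js + b *\<^sub>F h ks + c *\<^sub>F h ls \<in> I"
    unfolding h_def using foldl_in[OF rel] by (simp only: foldl_add_scale)
  moreover have "h ks \<in> fl.span (I \<union> B)" "h ls \<in> fl.span (I \<union> B)"
    using span_congruent[OF h] ks ls by blast+
  ultimately have "(h js + b *\<^sub>F h ks + c *\<^sub>F h ls) - c *\<^sub>F h ls - b *\<^sub>F h ks \<in> fl.span (I \<union> B)"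
    by (intro fl.span_diff fl.span_scale) (auto intro: fl.span_base)
  then have "h js \<in> fl.span (I \<union> B)" by simp
  moreover have "normed_monomial i (mset js + N) - h js \<in> I"
    using fl.subspace_neg[OF subspace h[of js]] by simp
  ultimately show ?thesis using span_congruent by blast
qed

lemma rmul_pow_relation:
  assumes "rmul_pow x\<^sub>1 x\<^sub>2 n + b *\<^sub>F rmul_pow x\<^sub>1 x\<^sub>2 m + c *\<^sub>F (x\<^sub>1 * x\<^sub>2) \<in> I"
  shows "foldl (*) (gen i) (map gen (replicate n j)) + b *\<^sub>F foldl (*) (gen i) (map gen (replicate m j))
      + c *\<^sub>F foldl (*) (gen i) (map gen [j]) \<in> I"
  using T_ideal_subst[OF T_ideal assms, of "\<lambda>l. if l = 0 then gen i else gen j"]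
  by (simp add: rmul_pow_conv_foldl fl.fl_eval_add fl.fl_eval_scale fl.fl_eval_foldl
      fl.fl_eval_mul fl.fl_eval_gen)

text \<open>The zero term gives the relation the three-term shape of
  \<open>normed_monomial_reduce\<close>.\<close>

lemma rmul_pow_commute_relation:
  assumes "rmul_pow (x\<^sub>1 * x\<^sub>2) x\<^sub>3 q - rmul_pow x\<^sub>1 x\<^sub>2 q * x\<^sub>3 \<in> I"
  shows "foldl (*) (gen i) (map gen (k # replicate q j))
      + (- 1) *\<^sub>F foldl (*) (gen i) (map gen (replicate q k @ [j]))
      + 0 *\<^sub>F foldl (*) (gen i) (map gen (replicate q k @ [j])) \<in> I"
  using T_ideal_subst[OF T_ideal assms,
      of "\<lambda>l. if l = 0 then gen i else if l = 1 then gen k else gen j"]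
  by (simp add: rmul_pow_conv_foldl fl.fl_eval_diff fl.fl_eval_foldl
      fl.fl_eval_mul fl.fl_eval_gen fl.scale_minus_left)

lemma span_normal_monomials:
  assumes "\<And>i M. normed_monomial i M \<in> fl.span (I \<union> B)"
  shows "fl.span (I \<union> B) = UNIV"
proof -
  have "I \<union> range (case_prod normed_monomial) \<subseteq> fl.span (I \<union> B)"
    using assms by (auto intro: fl.span_base)
  then have "fl.span (I \<union> range (case_prod normed_monomial)) \<subseteq> fl.span (I \<union> B)"
    by (intro fl.span_minimal fl.subspace_span)
  then show ?thesis unfolding span_normed_monomials by blast
qed

text \<open>Write an identity as g + b with g in \<open>I\<close> and b in the span of the normal
  monomials. Then b is an identity too, and independence forces b = 0.\<close>

lemma identities_eq:
  fixes \<alpha> :: 'k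
  assumes "\<alpha> \<noteq> 0" and le: "I \<subseteq> identities (*s) (L10_mul \<alpha>)"
    and span: "\<And>i M. normed_monomial i M \<in> fl.span (I \<union> normal_monomial ` normal_index \<alpha>)"
  shows "identities (*s) (L10_mul \<alpha>) = I"
proof
  show "identities (*s) (L10_mul \<alpha>) \<subseteq> I"
  proof
    fix f assume f: "f \<in> identities (*s) (L10_mul \<alpha>)"
    have "f \<in> fl.span (I \<union> normal_monomial ` normal_index \<alpha>)"
      using span_normal_monomials[OF span] by simp
    then obtain g b where g: "g \<in> fl.span I" and b: "b \<in> fl.span (normal_monomial ` normal_index \<alpha>)"
      and f_eq: "f = g + b"
      unfolding fl.span_Un by blast
    have g: "g \<in> I" using g subspace by (simp add: fl.span_eq_iff[THEN iffD2])
    obtain T r where T: "finite T" "T \<subseteq> normal_monomial ` normal_index \<alpha>"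
      and b_eq: "b = (\<Sum>v\<in>T. r v *\<^sub>F v)"
      using b by (auto simp: fl.span_explicit)
    \<comment> \<open>An index set on which \<open>normal_monomial\<close> is injective turns the
      combination of elements into one over indices.\<close>
    obtain J where J: "J \<subseteq> normal_index \<alpha>" "inj_on (normal_monomial :: _ \<Rightarrow> 'k free_leibniz) J" "T = normal_monomial ` J"
      using T(2) unfolding subset_image_inj by blast
    have "finite J" using T(1) J(2,3) finite_image_iff by blast
    have b_sum: "b = (\<Sum>x\<in>J. r (normal_monomial x) *\<^sub>F normal_monomial x)"
      using b_eq J(2,3) by (simp add: sum.reindex)
    have "b \<in> identities (*s) (L10_mul \<alpha>)"
      using f g le f_eq by (auto simp: identities_def L10.fl_eval_add subset_iff)
    then have "r (normal_monomial x) = 0" if "x \<in> J" for x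
      using normal_monomials_independent[OF assms(1) \<open>finite J\<close> J(1),
          of "\<lambda>x. r (normal_monomial x)" x] that unfolding b_sum by blast
    then have "b = 0" by (simp add: b_sum fl.scale_zero_left)
    then show "f \<in> I" using f_eq g by simp
  qed
qed (rule le)

lemma normed_monomial_in_span:
  fixes \<alpha> :: 'k
  assumes "\<And>j. infinite (UNIV :: 'k set) \<or> count M j < CARD('k)"
  shows "normed_monomial i M \<in> fl.span (I \<union> normal_monomial ` normal_index \<alpha>)"
proof -
  have "(i, M, False) \<in> normal_index \<alpha>" using assms by (simp add: normal_index_def)
  moreover have "normed_monomial i M = (normal_monomial (i, M, False) :: 'k free_leibniz)"
    by (simp add: normal_monomial_def)
  ultimately show ?thesis by (metis UnI2 fl.span_base imageI)
qed

text \<open>Replacing q factors x_j by a single one shortens the monomial because q \<ge> 2.\<close>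

lemma reduce_distinct_roots:
  fixes \<alpha> :: 'k
  assumes fin: "finite (UNIV :: 'k set)"
    and rel: "rmul_pow x\<^sub>1 x\<^sub>2 CARD('k) - x\<^sub>1 * x\<^sub>2 \<in> I"
  shows "normed_monomial i M \<in> fl.span (I \<union> normal_monomial ` normal_index \<alpha>)"
proof (induction "size M" arbitrary: M rule: less_induct)
  case less
  show ?case
  proof (cases "\<exists>j. CARD('k) \<le> count M j")
    case True
    then obtain j N where M: "M = replicate_mset CARD('k) j + N"
      by (metis count_le_replicate_mset_subset_eq subset_mset.le_iff_add)
    have "size ({#j#} + N) < size M"
      using two_le_card_field[OF fin] by (simp add: M)
    from less[OF this]
    have j: "normed_monomial i (mset [j] + N) \<in> fl.span (I \<union> normal_monomial ` normal_index \<alpha>)"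
      by simp
    have "rmul_pow x\<^sub>1 x\<^sub>2 CARD('k) + 0 *\<^sub>F rmul_pow x\<^sub>1 x\<^sub>2 1 + (- 1) *\<^sub>F (x\<^sub>1 * x\<^sub>2) \<in> I"
      using rel by (simp add: fl.scale_minus_left)
    from rmul_pow_relation[OF this, of i j]
    show ?thesis
      using normed_monomial_reduce[of i _ _ _ _ _ N] j by (fastforce simp: M)
  qed (auto intro: normed_monomial_in_span simp: not_le)
qed

text \<open>
  The exchange relation moves \<open>q\<close>-th powers towards the generator of least index, and the other
  relation then reduces the exponent of that generator; both decrease \<open>\<Sum>k\<in>#M. Suc k\<close>.
\<close>

lemma reduce_exchange:
  fixes \<alpha> :: 'k
  assumes fin: "finite (UNIV :: 'k set)" and const: "const_coeff \<alpha> CARD('k) \<noteq> 0"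
    and exchange: "rmul_pow (x\<^sub>1 * x\<^sub>2) x\<^sub>3 CARD('k) - rmul_pow x\<^sub>1 x\<^sub>2 CARD('k) * x\<^sub>3 \<in> I"
    and rel: "rmul_pow x\<^sub>1 x\<^sub>2 (2 * CARD('k) - 1) + \<beta> *\<^sub>F rmul_pow x\<^sub>1 x\<^sub>2 CARD('k) + x\<^sub>1 * x\<^sub>2 \<in> I"
  shows "normed_monomial i M \<in> fl.span (I \<union> normal_monomial ` normal_index \<alpha>)"
proof (induction "\<Sum>k\<in>#M. Suc k" arbitrary: M rule: less_induct)
  case less
  let ?q = "CARD('k)" and ?D = "fl.span (I \<union> normal_monomial ` normal_index \<alpha>)"
  have q: "2 \<le> ?q" by (rule two_le_card_field[OF fin])
  \<comment> \<open>The first two cases are reducible, the last two are normal with flag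
    \<open>False\<close> and \<open>True\<close>. Without a possible exchange, any exponent of at
    least q belongs to the least index, so \<open>shifted\<close> has only one such
    exponent.\<close>
  consider (exchange) j k where "k < j" "k \<in># M" "?q \<le> count M j"
    | (power) j where "2 * ?q - 1 \<le> count M j"
    | (reduced) "\<And>j. count M j < ?q"
    | (shifted) j where "?q \<le> count M j" "count M j < 2 * ?q - 1"
        "\<And>k. k \<in># M \<Longrightarrow> j \<le> k" "\<And>k. ?q \<le> count M k \<Longrightarrow> k = j"
  proof (cases "\<exists>j k. k < j \<and> k \<in># M \<and> ?q \<le> count M j")
    case True
    then show ?thesis using that(1) by blast
  next
    case False
    then have least: "j \<le> k" if "?q \<le> count M j" "k \<in># M" for j k
      using that by (meson not_le)
    moreover have "j \<in># M" if "?q \<le> count M j" for j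
      using that q by (intro count_inI) linarith
    ultimately have "k = j" if "?q \<le> count M j" "?q \<le> count M k" for j k
      using that by (meson order_antisym)
    then show ?thesis using that(2-4) least by (meson not_le)
  qed
  then show ?case
  proof cases
    case exchange
    obtain N\<^sub>0 where N\<^sub>0: "M = replicate_mset ?q j + N\<^sub>0"
      using exchange(3) by (metis count_le_replicate_mset_subset_eq subset_mset.le_iff_add)
    moreover have "k \<notin># replicate_mset ?q j" using exchange(1) by simp
    ultimately obtain N where "N\<^sub>0 = add_mset k N"
      using exchange(2) by (metis union_iff multi_member_split)
    then have M: "M = mset (k # replicate ?q j) + N" by (simp add: N\<^sub>0)
    \<comment> \<open>Replacing one x_k and q factors x_j by q factors x_k and one x_j lowers the
      weight by (q - 1) (j - k).\<close>
    obtain d where d: "j = k + d" "0 < d" using exchange(1) less_imp_add_positive by blast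
    have "d < ?q * d" using d q by simp
    then have "(\<Sum>k\<in>#mset (replicate ?q k @ [j]) + N. Suc k) < (\<Sum>k\<in>#M. Suc k)"
      by (simp add: M d algebra_simps sum_mset.distrib)
    from less[OF this] show ?thesis
      using normed_monomial_reduce[OF rmul_pow_commute_relation[OF assms(3)]] unfolding M by blast
  next
    case power
    then obtain N where M: "M = mset (replicate (2 * ?q - 1) j) + N"
      by (metis count_le_replicate_mset_subset_eq subset_mset.le_iff_add mset_replicate)
    have "?q < 2 * ?q - 1" using q by linarith
    then have "(\<Sum>k\<in>#mset (replicate ?q j) + N. Suc k) < (\<Sum>k\<in>#M. Suc k)"
      "(\<Sum>k\<in>#mset [j] + N. Suc k) < (\<Sum>k\<in>#M. Suc k)"
      using q by (simp_all add: M del: mult_Suc_right)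
    then have "normed_monomial i (mset (replicate ?q j) + N) \<in> ?D"
      "normed_monomial i (mset [j] + N) \<in> ?D"
      using less by blast+
    moreover have "rmul_pow x\<^sub>1 x\<^sub>2 (2 * ?q - 1) + \<beta> *\<^sub>F rmul_pow x\<^sub>1 x\<^sub>2 ?q + 1 *\<^sub>F (x\<^sub>1 * x\<^sub>2) \<in> I"
      using rel by simp
    ultimately show ?thesis
      using normed_monomial_reduce[OF rmul_pow_relation] unfolding M by blast
  next
    case reduced
    then show ?thesis by (intro normed_monomial_in_span) simp
  next
    case shifted
    \<comment> \<open>Removing q - 1 copies of j leaves between 1 and q - 1 of them, so j remains
      the least index of \<open>N\<close>.\<close>
    define N where "N = M - replicate_mset (?q - 1) j"
    have M: "M = N + replicate_mset (?q - 1) j"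
      using shifted(1) by (simp add: N_def count_le_replicate_mset_subset_eq[symmetric])
    have count: "count N k < ?q" for k
    proof (cases "k = j")
      case True
      have "count M j - (?q - 1) < ?q" using shifted(2) q by arith
      then show ?thesis by (simp add: N_def True)
    next
      case False
      then have "count M k < ?q" using shifted(4)[of k] by (meson not_le)
      then show ?thesis using False by (simp add: N_def)
    qed
    have j: "j \<in># N"
      using shifted(1) q by (intro count_inI) (simp add: N_def)
    have "Min_mset N = j"
      using shifted(3) j by (intro Min_eqI) (auto simp: M)
    then have "normed_monomial i M = (normal_monomial (i, N, True) :: 'k free_leibniz)"
      by (simp add: normal_monomial_def M)
    moreover have "(i, N, True) \<in> normal_index \<alpha>"
      using count j fin const by (auto simp: normal_index_def)
    ultimately show ?thesis by (metis UnI2 fl.span_base imageI)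
  qed
qed

end


section \<open>The generators are identities\<close>

lemma L10_eval_rmul_pow_nth:
  "L10_eval \<alpha> a (rmul_pow x y m) $ 1 = (L10_eval \<alpha> a y $ 3) ^ m *
     (const_coeff \<alpha> m * L10_eval \<alpha> a x $ 1 + \<alpha> * lin_coeff \<alpha> m * L10_eval \<alpha> a x $ 2)"
  "L10_eval \<alpha> a (rmul_pow x y m) $ 2 = (L10_eval \<alpha> a y $ 3) ^ m *
     (lin_coeff \<alpha> m * L10_eval \<alpha> a x $ 1
       + (lin_coeff \<alpha> m + const_coeff \<alpha> m) * L10_eval \<alpha> a x $ 2)"
  "L10_eval \<alpha> a (rmul_pow x y m) $ 3 = (if m = 0 then L10_eval \<alpha> a x $ 3 else 0)"
  by (simp_all add: rmul_pow_conv_foldl L10.fl_eval_foldl foldl_L10_mul_nth prod_list_replicate)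

text \<open>A product has no e_3-component, and right multiplication sees only that
  component.\<close>

lemma right_null_identity: "x\<^sub>1 * (x\<^sub>2 * x\<^sub>3) \<in> identities (*s) (L10_mul \<alpha>)"
  by (simp add: identities_def L10.fl_eval_mul vec_eq_iff forall_3 L10_mul_nth)

context
  fixes \<alpha> :: "'k::field"
  assumes fin: "finite (UNIV :: 'k set)"
begin

text \<open>With R^q = R and t^q = t the operators (t R)^q and t R agree.\<close>

lemma distinct_roots_identity:
  assumes "lin_coeff \<alpha> CARD('k) = 1" "const_coeff \<alpha> CARD('k) = 0"
  shows "rmul_pow x\<^sub>1 x\<^sub>2 CARD('k) - x\<^sub>1 * x\<^sub>2 \<in> identities (*s) (L10_mul \<alpha>)"
  using fin assms
  by (simp add: identities_def L10.fl_eval_diff L10.fl_eval_mul vec_eq_iff forall_3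
      L10_mul_nth L10_eval_rmul_pow_nth power_card_eq_same)

text \<open>Both products act as s t R^(q+1), where s and t are the e_3-coordinates of the values of
  x_2 and x_3.\<close>

lemma exchange_identity:
  "rmul_pow (x\<^sub>1 * x\<^sub>2) x\<^sub>3 CARD('k) - rmul_pow x\<^sub>1 x\<^sub>2 CARD('k) * x\<^sub>3
     \<in> identities (*s) (L10_mul \<alpha>)"
  using fin
  by (simp add: identities_def L10.fl_eval_diff L10.fl_eval_mul vec_eq_iff forall_3
      L10_mul_nth L10_eval_rmul_pow_nth power_card_eq_same algebra_simps)

text \<open>The hypotheses say R^(2q-1) + \<beta> R^q + R = 0, and the powers of a scalar t that
  accompany these terms all equal t.\<close>

lemma three_term_identity:
  assumes "lin_coeff \<alpha> (2 * CARD('k) - 1) + \<beta> * lin_coeff \<alpha> CARD('k) + 1 = 0"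
    and "const_coeff \<alpha> (2 * CARD('k) - 1) + \<beta> * const_coeff \<alpha> CARD('k) = 0"
  shows "rmul_pow x\<^sub>1 x\<^sub>2 (2 * CARD('k) - 1) + \<beta> *\<^sub>F rmul_pow x\<^sub>1 x\<^sub>2 CARD('k) + x\<^sub>1 * x\<^sub>2
    \<in> identities (*s) (L10_mul \<alpha>)"
proof -
  let ?q = "CARD('k)"
  have q: "2 \<le> ?q" by (rule two_le_card_field[OF fin])
  have pow: "t ^ ?q = t" "t ^ (2 * ?q - 1) = t" for t :: 'k
  proof -
    show *: "t ^ ?q = t" by (rule power_card_eq_same[OF fin])
    have "2 * ?q - 1 = ?q + (?q - 1)" "?q = Suc (?q - 1)" using q by linarith+
    then show "t ^ (2 * ?q - 1) = t" using * by (metis power_Suc power_add)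
  qed
  have C: "const_coeff \<alpha> (2 * ?q - 1) = - (\<beta> * const_coeff \<alpha> ?q)"
    and L: "lin_coeff \<alpha> (2 * ?q - 1) = - (\<beta> * lin_coeff \<alpha> ?q) - 1"
    using assms by (simp_all add: eq_neg_iff_add_eq_0 algebra_simps)
  have "\<not> 2 * ?q - 1 = 0" "?q \<noteq> 0" using q by linarith+
  then show ?thesis
    by (simp only: identities_def L10.fl_eval_add L10.fl_eval_scale L10.fl_eval_mul vec_eq_iff
        forall_3 L10_mul_nth L10_eval_rmul_pow_nth pow C L vector_add_component
        vector_smult_component zero_index mem_Collect_eq)
      (simp add: algebra_simps)
qed

text \<open>Compare coefficients in R R^(2q-1) = (R^q)^2; this determines R^(2q-1) from R^q.\<close>

lemma coeff_double_pred:
  assumes "\<alpha> \<noteq> 0"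
  shows "\<alpha> * lin_coeff \<alpha> (2 * CARD('k) - 1)
      = \<alpha> * lin_coeff \<alpha> CARD('k) * lin_coeff \<alpha> CARD('k) + const_coeff \<alpha> CARD('k) * const_coeff \<alpha> CARD('k)"
    "lin_coeff \<alpha> (2 * CARD('k) - 1) + const_coeff \<alpha> (2 * CARD('k) - 1)
      = lin_coeff \<alpha> CARD('k) * lin_coeff \<alpha> CARD('k)
        + 2 * lin_coeff \<alpha> CARD('k) * const_coeff \<alpha> CARD('k)"
proof -
  have eq: "Suc (2 * CARD('k) - 1) = CARD('k) + CARD('k)"
    using two_le_card_field[OF fin] by linarith
  show "\<alpha> * lin_coeff \<alpha> (2 * CARD('k) - 1)
      = \<alpha> * lin_coeff \<alpha> CARD('k) * lin_coeff \<alpha> CARD('k) + const_coeff \<alpha> CARD('k) * const_coeff \<alpha> CARD('k)"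
    unfolding const_coeff.simps(2)[symmetric] eq coeff_add by simp
  show "lin_coeff \<alpha> (2 * CARD('k) - 1) + const_coeff \<alpha> (2 * CARD('k) - 1)
      = lin_coeff \<alpha> CARD('k) * lin_coeff \<alpha> CARD('k)
        + 2 * lin_coeff \<alpha> CARD('k) * const_coeff \<alpha> CARD('k)"
    unfolding lin_coeff.simps(2)[symmetric] eq coeff_add by (simp add: algebra_simps)
qed

end

section \<open>Generators of the T-ideal of identities, case by case\<close>

lemma right_null_T_ideal_gen:
  assumes "x\<^sub>1 * (x\<^sub>2 * x\<^sub>3) \<in> S"
  shows "right_null_T_ideal (T_ideal_gen S)"
  using assms subset_T_ideal_gen[of S] by unfold_locales (auto intro: T_ideal_T_ideal_gen)

text \<open>Serves both the repeated root and the roots outside the field, which differ only in R^q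
  and \<beta>.\<close>

lemma identities_eq_exchange:
  fixes \<alpha> \<beta> :: "'k::field"
  assumes "\<alpha> \<noteq> 0" and fin: "finite (UNIV :: 'k set)" and const: "const_coeff \<alpha> CARD('k) \<noteq> 0"
    and lin2: "lin_coeff \<alpha> (2 * CARD('k) - 1) + \<beta> * lin_coeff \<alpha> CARD('k) + 1 = 0"
    and const2: "const_coeff \<alpha> (2 * CARD('k) - 1) + \<beta> * const_coeff \<alpha> CARD('k) = 0"
  shows "identities (*s) (L10_mul \<alpha>) = T_ideal_gen
    {x\<^sub>1 * (x\<^sub>2 * x\<^sub>3),
     rmul_pow (x\<^sub>1 * x\<^sub>2) x\<^sub>3 CARD('k) - rmul_pow x\<^sub>1 x\<^sub>2 CARD('k) * x\<^sub>3,
     rmul_pow x\<^sub>1 x\<^sub>2 (2 * CARD('k) - 1) + \<beta> *\<^sub>F rmul_pow x\<^sub>1 x\<^sub>2 CARD('k) + x\<^sub>1 * x\<^sub>2}"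
    (is "_ = T_ideal_gen ?S")
proof -
  interpret right_null_T_ideal "T_ideal_gen ?S" by (rule right_null_T_ideal_gen) simp
  have "?S \<subseteq> identities (*s) (L10_mul \<alpha>)"
    using right_null_identity exchange_identity[OF fin] three_term_identity[OF fin lin2 const2]
    by blast
  then have "T_ideal_gen ?S \<subseteq> identities (*s) (L10_mul \<alpha>)"
    by (intro T_ideal_gen_subset L10.T_ideal_identities)
  then show ?thesis
    using subset_T_ideal_gen[of ?S]
    by (intro identities_eq reduce_exchange[OF fin const, of \<beta>] assms(1)) auto
qed

theorem theorem3p16:
  fixes \<alpha> :: "'k::field"
  assumes "\<alpha> \<noteq> 0"
  shows
    "(infinite (UNIV :: 'k set) \<longrightarrow>
        identities (*s) (L10_mul \<alpha>) = T_ideal_gen {x\<^sub>1 * (x\<^sub>2 * x\<^sub>3)}) \<and>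
     (\<forall>q r\<^sub>1 r\<^sub>2.
        finite (UNIV :: 'k set) \<and> q = CARD('k) \<and>
        map_poly to_ac [:- \<alpha>, - 1, 1:] = [:- r\<^sub>1, 1:] * [:- r\<^sub>2, 1:] \<longrightarrow>
        (r\<^sub>1 \<noteq> r\<^sub>2 \<and> r\<^sub>1 \<in> range to_ac \<and> r\<^sub>2 \<in> range to_ac \<longrightarrow>
           identities (*s) (L10_mul \<alpha>) =
             T_ideal_gen
              {x\<^sub>1 * (x\<^sub>2 * x\<^sub>3),
               rmul_pow x\<^sub>1 x\<^sub>2 q - x\<^sub>1 * x\<^sub>2}) \<and>
        (r\<^sub>1 = r\<^sub>2 \<and> r\<^sub>1 \<in> range to_ac \<longrightarrow>
           identities (*s) (L10_mul \<alpha>) =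
             T_ideal_gen
              {x\<^sub>1 * (x\<^sub>2 * x\<^sub>3),
               rmul_pow (x\<^sub>1 * x\<^sub>2) x\<^sub>3 q - rmul_pow x\<^sub>1 x\<^sub>2 q * x\<^sub>3,
               rmul_pow x\<^sub>1 x\<^sub>2 (2 * q - 1) - 2 *\<^sub>F rmul_pow x\<^sub>1 x\<^sub>2 q + x\<^sub>1 * x\<^sub>2}) \<and>
        (r\<^sub>1 \<notin> range to_ac \<and> r\<^sub>2 \<notin> range to_ac \<longrightarrow>
           identities (*s) (L10_mul \<alpha>) =
             T_ideal_gen
              {x\<^sub>1 * (x\<^sub>2 * x\<^sub>3),
               rmul_pow (x\<^sub>1 * x\<^sub>2) x\<^sub>3 q - rmul_pow x\<^sub>1 x\<^sub>2 q * x\<^sub>3,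
               rmul_pow x\<^sub>1 x\<^sub>2 (2 * q - 1)
                 + (inverse \<alpha> * (1 + 2 * \<alpha>)) *\<^sub>F rmul_pow x\<^sub>1 x\<^sub>2 q + x\<^sub>1 * x\<^sub>2}))"
proof (intro conjI allI impI; (elim conjE)?)
  let ?S = "{x\<^sub>1 * (x\<^sub>2 * x\<^sub>3)} :: 'k free_leibniz set"
  assume inf: "infinite (UNIV :: 'k set)"
  interpret right_null_T_ideal "T_ideal_gen ?S" by (rule right_null_T_ideal_gen) simp
  have "T_ideal_gen ?S \<subseteq> identities (*s) (L10_mul \<alpha>)"
    using right_null_identity by (intro T_ideal_gen_subset L10.T_ideal_identities) blast
  then show "identities (*s) (L10_mul \<alpha>) = T_ideal_gen ?S"
    using inf by (intro identities_eq normed_monomial_in_span assms) auto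
next
  fix q r\<^sub>1 r\<^sub>2
  assume fin: "finite (UNIV :: 'k set)" and q: "q = CARD('k)"
    and fact: "map_poly to_ac [:- \<alpha>, - 1, 1:] = [:- r\<^sub>1, 1:] * [:- r\<^sub>2, 1:]"
    and roots: "r\<^sub>1 \<noteq> r\<^sub>2" "r\<^sub>1 \<in> range to_ac" "r\<^sub>2 \<in> range to_ac"
  let ?S = "{x\<^sub>1 * (x\<^sub>2 * x\<^sub>3), rmul_pow x\<^sub>1 x\<^sub>2 q - x\<^sub>1 * x\<^sub>2} :: 'k free_leibniz set"
  interpret right_null_T_ideal "T_ideal_gen ?S" by (rule right_null_T_ideal_gen) simp
  have "?S \<subseteq> identities (*s) (L10_mul \<alpha>)"
    using right_null_identity
      distinct_roots_identity[OF fin coeff_card_distinct_roots[OF fin fact roots]]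
    unfolding q by blast
  then have "T_ideal_gen ?S \<subseteq> identities (*s) (L10_mul \<alpha>)"
    by (intro T_ideal_gen_subset L10.T_ideal_identities)
  then show "identities (*s) (L10_mul \<alpha>) = T_ideal_gen ?S"
    using subset_T_ideal_gen[of ?S]
    by (intro identities_eq reduce_distinct_roots[OF fin] assms) (auto simp: q)
next
  fix q r\<^sub>1 r\<^sub>2
  assume fin: "finite (UNIV :: 'k set)" and q: "q = CARD('k)"
    and fact: "map_poly to_ac [:- \<alpha>, - 1, 1:] = [:- r\<^sub>1, 1:] * [:- r\<^sub>2, 1:]"
    and roots: "r\<^sub>1 = r\<^sub>2" "r\<^sub>1 \<in> range to_ac"
  obtain r where r: "2 * r = 1" "r * r = - \<alpha>" "r \<noteq> 0"
    and coeffs: "lin_coeff \<alpha> CARD('k) = 0" "const_coeff \<alpha> CARD('k) = r"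
    by (rule coeff_card_double_root[OF fin fact roots assms])
  \<comment> \<open>From R^q = r and r^2 = - \<alpha> follows R^(2q-1) = - \<alpha> R^(-1) = 1 -
    R.\<close>
  have "\<alpha> * (lin_coeff \<alpha> (2 * q - 1) + 1) = 0"
    using coeff_double_pred(1)[OF fin assms] by (simp add: coeffs r q algebra_simps)
  then have lin: "lin_coeff \<alpha> (2 * q - 1) = - 1"
    using assms by (simp add: eq_neg_iff_add_eq_0)
  have const: "const_coeff \<alpha> (2 * q - 1) = 1"
    using coeff_double_pred(2)[OF fin assms] lin by (simp add: coeffs q)
  have "rmul_pow x\<^sub>1 x\<^sub>2 (2 * q - 1) - 2 *\<^sub>F rmul_pow x\<^sub>1 x\<^sub>2 q + x\<^sub>1 * x\<^sub>2
    = rmul_pow x\<^sub>1 x\<^sub>2 (2 * q - 1) + (- 2 :: 'k) *\<^sub>F rmul_pow x\<^sub>1 x\<^sub>2 q + x\<^sub>1 * x\<^sub>2"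
    by (simp add: fl.scale_minus_left)
  then show "identities (*s) (L10_mul \<alpha>) = T_ideal_gen
      {x\<^sub>1 * (x\<^sub>2 * x\<^sub>3), rmul_pow (x\<^sub>1 * x\<^sub>2) x\<^sub>3 q - rmul_pow x\<^sub>1 x\<^sub>2 q * x\<^sub>3,
       rmul_pow x\<^sub>1 x\<^sub>2 (2 * q - 1) - 2 *\<^sub>F rmul_pow x\<^sub>1 x\<^sub>2 q + x\<^sub>1 * x\<^sub>2}"
    using identities_eq_exchange[OF assms fin, of "- 2"] lin const r by (simp add: coeffs q)
next
  fix q r\<^sub>1 r\<^sub>2
  assume fin: "finite (UNIV :: 'k set)" and q: "q = CARD('k)"
    and fact: "map_poly to_ac [:- \<alpha>, - 1, 1:] = [:- r\<^sub>1, 1:] * [:- r\<^sub>2, 1:]"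
    and roots: "r\<^sub>1 \<notin> range to_ac" "r\<^sub>2 \<notin> range to_ac"
  let ?\<beta> = "inverse \<alpha> * (1 + 2 * \<alpha>)"
  note coeffs = coeff_card_conjugate_roots[OF fin fact roots]
  have \<beta>: "?\<beta> = inverse \<alpha> + 2"
    using assms by (simp add: field_simps)
  \<comment> \<open>From R^q = 1 - R follows R^(2q-1) = (1 + \<alpha>^(-1)) R - 2 -
    \<alpha>^(-1).\<close>
  have "\<alpha> * lin_coeff \<alpha> (2 * q - 1) = \<alpha> * (1 + inverse \<alpha>)"
    using coeff_double_pred(1)[OF fin assms] assms by (simp add: coeffs q distrib_left)
  then have lin: "lin_coeff \<alpha> (2 * q - 1) = 1 + inverse \<alpha>"
    using assms by simp
  have "const_coeff \<alpha> (2 * q - 1) = - 1 - lin_coeff \<alpha> (2 * q - 1)"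
    using coeff_double_pred(2)[OF fin assms] by (simp add: coeffs q eq_diff_eq add.commute)
  then have const: "const_coeff \<alpha> (2 * q - 1) = - 2 - inverse \<alpha>"
    unfolding lin by simp
  show "identities (*s) (L10_mul \<alpha>) = T_ideal_gen
      {x\<^sub>1 * (x\<^sub>2 * x\<^sub>3), rmul_pow (x\<^sub>1 * x\<^sub>2) x\<^sub>3 q - rmul_pow x\<^sub>1 x\<^sub>2 q * x\<^sub>3,
       rmul_pow x\<^sub>1 x\<^sub>2 (2 * q - 1) + ?\<beta> *\<^sub>F rmul_pow x\<^sub>1 x\<^sub>2 q + x\<^sub>1 * x\<^sub>2}"
    unfolding q
    by (rule identities_eq_exchange[OF assms fin]) (use lin const in \<open>simp_all add: coeffs q \<beta>\<close>)
qed

end
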